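(* Every poset in the class $\mathcal P$ belongs to the class $\mathrm H$; that is, $\mathcal P\subseteq\mathrm H$.
   Context: All posets are finite and all graphs are finite, simple and undirected. A poset is identified with its ground set; $|P|$ is its size; $\mathbf 1$ is the one-element poset. Sums and duals. For posets $P,Q$ with disjoint ground sets, the direct sum $P+Q$ is the poset on $P\cup Q$ with $x\le y$ iff ($x,y\in P$ and $x\le y$ in $P$) or ($x,y\in Q$ and $x\le y$ in $Q$). The ordinal sum $P\oplus Q$ is the poset on $P\cup Q$ with $x\le y$ iff ($x,y\in P$ and $x\le y$ in $P$) or ($x,y\in Q$ and $x\le y$ in $Q$) or ($x\in P$ and $y\in Q$). The dual $P^*$ has the same ground set as $P$, with $x\le y$ in $P^*$ iff $y\le x$ in $P$. For $n\ge 1$, $\mathbf n=\mathbf 1+\cdots+\mathbf 1$ ($n$ summands) is the $n$-element antichain. Series-parallel posets. A nonempty poset is series-parallel if it can be constructed, up to isomorphism, from $\mathbf 1$ by repeated direct sums and ordinal sums; $\mathrm{SP}$ is the class of all series-parallel posets. The class $\mathcal P$. It is defined recursively (up to poset isomorphism) by: (i) $\mathbf 1\in\mathcal P$; (ii) if $P\in\mathcal P$ then $P\oplus\mathbf n\in\mathcal P$ for every integer $n\ge 1$; (iii) if $P,Q\in\mathcal P$ then $P+Q\in\mathcal P$; (iv) if $P\in\mathcal P$ then $P^*\in\mathcal P$. Tutte polynomial. An order ideal of $P$ is a subset $I\subseteq P$ such that $u\in I$, $v\in P$, $v\le u$ imply $v\in I$. For $S\subseteq P$ let $\rho_P(S)=\max\{|I|: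 I\subseteq S,\ I\text{ an order ideal of }P\}$. Then $$T(P;x,y)=\sum_{S\subseteq P}(x-1)^{|P|-\rho_P(S)}(y-1)^{|S|-\rho_P(S)}.$$ The class $\mathrm H$. For $W\subseteq P$, $P[W]$ is the induced subposet on $W$. The comparability graph $G(P)$ has vertex set $P$ and edges $\{s,t\}$ for $s<t$ in $P$; $\overline{G(P)}$ is its complement (the incomparability graph). For a graph $G$ and $W\subseteq V(G)$, $G[W]$ is the induced subgraph, and $\mathcal C(G)$ is the set of connected components of $G$. For $P\in\mathrm{SP}$ with $G=G(P)$, let $\mathcal W(P)\subseteq 2^P\setminus\{\varnothing\}$ be the smallest family with respect to inclusion such that $P\in\mathcal W(P)$ and, for every $W\in\mathcal W(P)$ and every $C\in\mathcal C(G[W])\cup\mathcal C(\overline G[W])$, we have $V(C)\in\mathcal W(P)$. The class $\mathrm H$ consists of all $P\in\mathrm{SP}$ such that for every $W\in\mathcal W(P)$, if $G(P[W])$ is disconnected, then for every $C\in\mathcal C(G(P[W]))$ the polynomial $T(P[V(C)];x,y)$ is irreducible in $\mathbb Q[x,y]$. *)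

theory Defs
  imports "HOL-Computational_Algebra.Computational_Algebra"
begin

section \<open>Posets\<close>

text \<open>A finite poset is a relation \<open>P :: 'a rel\<close> with \<open>Partial_order P\<close> and \<open>finite (Field P)\<close>:
  \<open>(x, y) \<in> P\<close> means \<open>x \<le> y\<close> in \<open>P\<close>, and by reflexivity \<open>Field P\<close> is the ground set. The dual is
  \<open>P\<inverse>\<close>, the induced subposet on \<open>W\<close> is \<open>Restr P W\<close>, the one-element poset on \<open>{a}\<close>
  is \<open>{(a, a)}\<close>, and the antichain on \<open>A\<close> is \<open>Id_on A\<close>.\<close>

text \<open>Both sums are meant for disjoint ground sets; this is required wherever they are used.\<close>

definition direct_sum :: "'a rel \<Rightarrow> 'a rel \<Rightarrow> 'a rel" where
  "direct_sum P Q = P \<union> Q"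

definition ordinal_sum :: "'a rel \<Rightarrow> 'a rel \<Rightarrow> 'a rel" where
  "ordinal_sum P Q = P \<union> Q \<union> Field P \<times> Field Q"

text \<open>The two classes of posets are taken on an arbitrary type \<open>'a\<close>, with all summands living on
  (disjoint) subsets of that type. No separate isomorphism rule is needed, as a decomposition of a
  poset can be transported along an isomorphism: see \<open>SP_iso\<close> and \<open>class_P_iso\<close>, where the two
  posets may even have different types.\<close>

inductive_set SP :: "'a rel set" where
  SP_one: "{(a, a)} \<in> SP"
| SP_direct_sum: "P \<in> SP \<Longrightarrow> Q \<in> SP \<Longrightarrow> Field P \<inter> Field Q = {} \<Longrightarrow> direct_sum P Q \<in> SP"
| SP_ordinal_sum: "P \<in> SP \<Longrightarrow> Q \<in> SP \<Longrightarrow> Field P \<inter> Field Q = {} \<Longrightarrow> ordinal_sum P Q \<in> SP"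

inductive_set class_P :: "'a rel set" where
  class_P_one: "{(a, a)} \<in> class_P"
| class_P_ordinal_sum: "P \<in> class_P \<Longrightarrow> n \<ge> 1 \<Longrightarrow> finite A \<Longrightarrow> card A = n \<Longrightarrow> Field P \<inter> A = {} \<Longrightarrow>
    ordinal_sum P (Id_on A) \<in> class_P"
| class_P_direct_sum: "P \<in> class_P \<Longrightarrow> Q \<in> class_P \<Longrightarrow> Field P \<inter> Field Q = {} \<Longrightarrow>
    direct_sum P Q \<in> class_P"
| class_P_dual: "P \<in> class_P \<Longrightarrow> P\<inverse> \<in> class_P"

lemma Field_direct_sum: "Field (direct_sum P Q) = Field P \<union> Field Q"
  by (auto simp: direct_sum_def)

lemma Field_ordinal_sum: "Field (ordinal_sum P Q) = Field P \<union> Field Q"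
  by (auto simp: ordinal_sum_def Field_def)

lemma partial_order_sums:
  assumes "Partial_order P" "Partial_order Q" "Field P \<inter> Field Q = {}"
  shows "Partial_order (direct_sum P Q)" "Partial_order (ordinal_sum P Q)"
proof -
  have refl: "\<And>x. x \<in> Field P \<Longrightarrow> (x, x) \<in> P" "\<And>x. x \<in> Field Q \<Longrightarrow> (x, x) \<in> Q"
    and trans: "\<And>x y z. (x, y) \<in> P \<Longrightarrow> (y, z) \<in> P \<Longrightarrow> (x, z) \<in> P"
      "\<And>x y z. (x, y) \<in> Q \<Longrightarrow> (y, z) \<in> Q \<Longrightarrow> (x, z) \<in> Q"
    and antisym: "\<And>x y. (x, y) \<in> P \<Longrightarrow> (y, x) \<in> P \<Longrightarrow> x = y"
      "\<And>x y. (x, y) \<in> Q \<Longrightarrow> (y, x) \<in> Q \<Longrightarrow> x = y"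
    using assms(1,2)
    by (auto simp: partial_order_on_def preorder_on_def refl_on_def
        dest: antisymD elim: transE)
  have field: "\<And>x y. (x, y) \<in> P \<Longrightarrow> x \<in> Field P \<and> y \<in> Field P"
    "\<And>x y. (x, y) \<in> Q \<Longrightarrow> x \<in> Field Q \<and> y \<in> Field Q"
    by (auto simp: Field_def)
  have disj: "\<And>x. x \<in> Field P \<Longrightarrow> x \<in> Field Q \<Longrightarrow> False"
    using assms(3) by blast
  have sub: "r \<subseteq> Field r \<times> Field r" for r :: "'a rel"
    by (auto simp: Field_def)
  show "Partial_order (direct_sum P Q)"
    unfolding partial_order_on_def preorder_on_def
  proof (intro conjI)
    show "refl_on (Field (direct_sum P Q)) (direct_sum P Q)"
      unfolding refl_on_def Field_direct_sum by (auto simp: direct_sum_def refl)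
    show "direct_sum P Q \<subseteq> Field (direct_sum P Q) \<times> Field (direct_sum P Q)" by (rule sub)
    show "trans (direct_sum P Q)" unfolding trans_def direct_sum_def
      by (blast dest: field disj intro: trans)
    show "antisym (direct_sum P Q)" unfolding antisym_def direct_sum_def
      by (blast dest: field disj antisym)
  qed
  show "Partial_order (ordinal_sum P Q)"
    unfolding partial_order_on_def preorder_on_def
  proof (intro conjI)
    show "refl_on (Field (ordinal_sum P Q)) (ordinal_sum P Q)"
      unfolding refl_on_def Field_ordinal_sum by (auto simp: ordinal_sum_def refl)
    show "ordinal_sum P Q \<subseteq> Field (ordinal_sum P Q) \<times> Field (ordinal_sum P Q)" by (rule sub)
    show "trans (ordinal_sum P Q)" unfolding trans_def ordinal_sum_def
      by (blast dest: field disj intro: trans)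
    show "antisym (ordinal_sum P Q)" unfolding antisym_def ordinal_sum_def
      by (blast dest: field disj antisym)
  qed
qed

lemma SP_finite_poset: "P \<in> SP \<Longrightarrow> Partial_order P \<and> finite (Field P) \<and> Field P \<noteq> {}"
proof (induction rule: SP.induct)
  case (SP_one a)
  have "Field {(a, a)} = {a}" by (auto simp: Field_def)
  then show ?case
    by (auto simp: partial_order_on_def preorder_on_def refl_on_def trans_def antisym_def)
qed (auto simp: partial_order_sums[unfolded Field_direct_sum Field_ordinal_sum]
    Field_direct_sum Field_ordinal_sum)

lemma class_P_finite_poset:
  "P \<in> class_P \<Longrightarrow> Partial_order P \<and> finite (Field P) \<and> Field P \<noteq> {}"
proof (induction rule: class_P.induct)
  case (class_P_one a)
  then show ?case using SP_finite_poset[OF SP_one] .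
next
  case (class_P_ordinal_sum P n A)
  have F: "Field (Id_on A) = A" by (auto simp: Field_def)
  then have "Partial_order (Id_on A)"
    by (auto simp: partial_order_on_def preorder_on_def refl_on_def trans_def antisym_def)
  with class_P_ordinal_sum F show ?case
    using partial_order_sums(2)[of P "Id_on A"] by (simp add: Field_ordinal_sum)
qed (auto simp: partial_order_sums[unfolded Field_direct_sum Field_ordinal_sum]
    Field_direct_sum Field_converse partial_order_on_converse)

lemma Field_map_prod: "Field (map_prod f f ` P) = f ` Field P"
  by (force simp: Field_def)

lemma map_direct_sum:
  "map_prod f f ` direct_sum P Q = direct_sum (map_prod f f ` P) (map_prod f f ` Q)"
  by (simp add: direct_sum_def image_Un)

lemma map_ordinal_sum:
  "map_prod f f ` ordinal_sum P Q = ordinal_sum (map_prod f f ` P) (map_prod f f ` Q)"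
  by (simp add: ordinal_sum_def image_Un Field_map_prod map_prod_surj_on[OF refl refl])

lemma iso_imp_image:
  assumes "iso P Q f"
  shows "inj_on f (Field P)" "Q = map_prod f f ` P"
proof -
  from assms have bij: "bij_betw f (Field P) (Field Q)"
    and emb: "\<And>a. a \<in> Field P \<Longrightarrow> bij_betw f (under P a) (under Q (f a))"
    by (auto simp: iso_def embed_def)
  show "inj_on f (Field P)" using bij by (simp add: bij_betw_def)
  show "Q = map_prod f f ` P"
  proof (intro equalityI subsetI)
    fix p assume "p \<in> Q"
    then obtain c d where p: "p = (c, d)" and cd: "(c, d) \<in> Q" by (cases p) auto
    then have "d \<in> Field Q" by (auto simp: Field_def)
    then obtain b where b: "b \<in> Field P" "d = f b" using bij by (auto simp: bij_betw_def)
    have "c \<in> f ` under P b"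
      using emb[OF b(1)] cd b(2) by (auto simp: bij_betw_def under_def)
    then show "p \<in> map_prod f f ` P" using p b by (auto simp: under_def)
  next
    fix p assume "p \<in> map_prod f f ` P"
    then obtain a b where p: "p = (f a, f b)" and ab: "(a, b) \<in> P" by auto
    then have "f ` under P b = under Q (f b)"
      using emb[of b] by (auto simp: Field_def bij_betw_def)
    then show "p \<in> Q" using p ab by (auto simp: under_def)
  qed
qed

lemma disjoint_map:
  assumes "inj_on f (A \<union> B)" "A \<inter> B = {}"
  shows "f ` A \<inter> f ` B = {}"
  using assms by (auto simp: inj_on_def)

lemma SP_image: "P \<in> SP \<Longrightarrow> inj_on f (Field P) \<Longrightarrow> map_prod f f ` P \<in> SP"
proof (induction rule: SP.induct)
  case (SP_one a)
  then show ?case by (simp add: SP.SP_one)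
next
  case (SP_direct_sum P Q)
  then have inj: "inj_on f (Field P \<union> Field Q)" by (simp add: Field_direct_sum)
  then have "inj_on f (Field P)" "inj_on f (Field Q)" by (simp_all add: inj_on_Un)
  moreover have "Field (map_prod f f ` P) \<inter> Field (map_prod f f ` Q) = {}"
    using disjoint_map[OF inj SP_direct_sum.hyps(3)] by (simp only: Field_map_prod)
  ultimately show ?case
    unfolding map_direct_sum using SP_direct_sum.IH by (intro SP.SP_direct_sum)
next
  case (SP_ordinal_sum P Q)
  then have inj: "inj_on f (Field P \<union> Field Q)" by (simp add: Field_ordinal_sum)
  then have "inj_on f (Field P)" "inj_on f (Field Q)" by (simp_all add: inj_on_Un)
  moreover have "Field (map_prod f f ` P) \<inter> Field (map_prod f f ` Q) = {}"
    using disjoint_map[OF inj SP_ordinal_sum.hyps(3)] by (simp only: Field_map_prod)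
  ultimately show ?case
    unfolding map_ordinal_sum using SP_ordinal_sum.IH by (intro SP.SP_ordinal_sum)
qed

lemma class_P_image: "P \<in> class_P \<Longrightarrow> inj_on f (Field P) \<Longrightarrow> map_prod f f ` P \<in> class_P"
proof (induction rule: class_P.induct)
  case (class_P_one a)
  then show ?case by (simp add: class_P.class_P_one)
next
  case (class_P_ordinal_sum P n A)
  have FA: "Field (Id_on A) = A" by (auto simp: Field_def)
  have inj: "inj_on f (Field P \<union> A)"
    using class_P_ordinal_sum.prems by (simp add: Field_ordinal_sum FA)
  then have injP: "inj_on f (Field P)" and injA: "inj_on f A"
    by (auto simp: inj_on_def)
  have "map_prod f f ` Id_on A = Id_on (f ` A)" by force
  moreover have "Field (map_prod f f ` P) \<inter> f ` A = {}"
    using disjoint_map[OF inj] class_P_ordinal_sum.hyps by (simp add: Field_map_prod)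
  ultimately show ?case
    unfolding map_ordinal_sum
    using class_P_ordinal_sum.hyps class_P_ordinal_sum.IH[OF injP] card_image[OF injA]
      class_P.class_P_ordinal_sum[of "map_prod f f ` P" n "f ` A"]
    by simp
next
  case (class_P_direct_sum P Q)
  then have inj: "inj_on f (Field P \<union> Field Q)" by (simp add: Field_direct_sum)
  then have "inj_on f (Field P)" "inj_on f (Field Q)" by (simp_all add: inj_on_Un)
  moreover have "Field (map_prod f f ` P) \<inter> Field (map_prod f f ` Q) = {}"
    using disjoint_map[OF inj class_P_direct_sum.hyps(3)] by (simp only: Field_map_prod)
  ultimately show ?case
    unfolding map_direct_sum using class_P_direct_sum.IH by (intro class_P.class_P_direct_sum)
next
  case (class_P_dual P)
  have "map_prod f f ` (P\<inverse>) = (map_prod f f ` P)\<inverse>" by force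
  with class_P_dual show ?case by (simp add: class_P.class_P_dual)
qed

lemma SP_iso: "P \<in> SP \<Longrightarrow> iso P Q f \<Longrightarrow> Q \<in> SP"
  using SP_image[of P f] iso_imp_image[of P Q f] by simp

lemma class_P_iso: "P \<in> class_P \<Longrightarrow> iso P Q f \<Longrightarrow> Q \<in> class_P"
  using class_P_image[of P f] iso_imp_image[of P Q f] by simp


section \<open>Tutte polynomial\<close>

definition order_ideal :: "'a rel \<Rightarrow> 'a set \<Rightarrow> bool" where
  "order_ideal P I \<longleftrightarrow> I \<subseteq> Field P \<and> (\<forall>u\<in>I. \<forall>v\<in>Field P. (v, u) \<in> P \<longrightarrow> v \<in> I)"

definition ideal_rank :: "'a rel \<Rightarrow> 'a set \<Rightarrow> nat" where
  "ideal_rank P S = Max {card I | I. I \<subseteq> S \<and> order_ideal P I}"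

text \<open>The ring \<open>\<rat>[x, y]\<close> is rendered as \<open>\<rat>[x][y]\<close>, that is, as the type \<open>rat poly poly\<close>.\<close>

definition var_x :: "rat poly poly" where
  "var_x = [:[:0, 1:]:]"

definition var_y :: "rat poly poly" where
  "var_y = [:0, 1:]"

text \<open>Neither subtraction of natural numbers truncates, because \<open>ideal_rank P S \<le> card S\<close> and
  \<open>card S \<le> card (Field P)\<close> for finite \<open>P\<close>.\<close>

definition tutte :: "'a rel \<Rightarrow> rat poly poly" where
  "tutte P = (\<Sum>S\<in>Pow (Field P).
     (var_x - 1) ^ (card (Field P) - ideal_rank P S) * (var_y - 1) ^ (card S - ideal_rank P S))"


section \<open>Graphs\<close>

text \<open>Simple undirected graphs; the edges are two-element sets of vertices.\<close>

record 'a ugraph =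
  verts :: "'a set"
  edges :: "'a set set"

definition comparability_graph :: "'a rel \<Rightarrow> 'a ugraph" where
  "comparability_graph P =
     \<lparr>verts = Field P, edges = {{s, t} | s t. (s, t) \<in> P \<and> s \<noteq> t}\<rparr>"

definition graph_complement :: "'a ugraph \<Rightarrow> 'a ugraph" where
  "graph_complement G =
     \<lparr>verts = verts G,
      edges = {{s, t} | s t. s \<in> verts G \<and> t \<in> verts G \<and> s \<noteq> t} - edges G\<rparr>"

definition induced_subgraph :: "'a ugraph \<Rightarrow> 'a set \<Rightarrow> 'a ugraph" where
  "induced_subgraph G W = \<lparr>verts = W, edges = {e \<in> edges G. e \<subseteq> W}\<rparr>"

definition reachable :: "'a ugraph \<Rightarrow> 'a rel" where
  "reachable G = {(u, v). {u, v} \<in> edges G}\<^sup>*"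

definition connected_graph :: "'a ugraph \<Rightarrow> bool" where
  "connected_graph G \<longleftrightarrow> (\<forall>u\<in>verts G. \<forall>v\<in>verts G. (u, v) \<in> reachable G)"

text \<open>A connected component is represented by its vertex set; these are the classes of
  reachability on the vertices.\<close>

definition components :: "'a ugraph \<Rightarrow> 'a set set" where
  "components G = verts G // reachable G"


section \<open>The class H\<close>

inductive_set family_W :: "'a rel \<Rightarrow> 'a set set" for P :: "'a rel" where
  family_W_top: "Field P \<in> family_W P"
| family_W_component: "W \<in> family_W P \<Longrightarrow>
    C \<in> components (induced_subgraph (comparability_graph P) W) \<Longrightarrow> C \<in> family_W P"
| family_W_cocomponent: "W \<in> family_W P \<Longrightarrow>
    C \<in> components (induced_subgraph (graph_complement (comparability_graph P)) W) \<Longrightarrow>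
    C \<in> family_W P"

definition class_H :: "'a rel set" where
  "class_H = {P \<in> SP. \<forall>W\<in>family_W P.
     \<not> connected_graph (comparability_graph (Restr P W)) \<longrightarrow>
       (\<forall>C\<in>components (comparability_graph (Restr P W)). irreducible (tutte (Restr P C)))}"

end

theory Submission
  imports Defs "HOL-Computational_Algebra.Field_as_Ring"
begin

text \<open>Put \<open>u = (x - 1) y\<close>. Since \<open>T(P + Q) = T(P) T(Q)\<close> and
  \<open>T(P \<oplus> Q) = T(Q) + u\<^bsup>|Q|\<^esup> (T(P) - 1)\<close>, the Tutte polynomial of a series-parallel poset is a
  polynomial \<open>B\<^sub>P(u, x)\<close>, and irreducibility in \<open>\<rat>[x][u]\<close> implies irreducibility in \<open>\<rat>[x, y]\<close>.
  For \<open>\<^bold>n \<oplus> P\<close> this polynomial is \<open>B\<^sub>P + u\<^bsup>|P|\<^esup> (x\<^sup>n - 1)\<close>, where \<open>B\<^sub>P\<close> has degree less than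
  \<open>|P|\<close> in \<open>u\<close> and \<open>B\<^sub>P(u, 1) = 1\<close>: Eisenstein's criterion at the prime \<open>x - 1\<close>, with leading and
  constant coefficient interchanged, applies. For \<open>P \<oplus> \<^bold>n\<close> it is \<open>x\<^sup>n + u\<^sup>n (B\<^sub>P - 1)\<close>; substituting
  \<open>x u\<close> for \<open>x\<close> and cancelling \<open>u\<^sup>n\<close> leaves \<open>x\<^sup>n - 1 + B\<^sub>P(u, x u)\<close>, to which the usual Eisenstein
  criterion at \<open>x - 1\<close> applies because \<open>B\<^sub>P(u, u) = u\<^bsup>|P|\<^esup>\<close>. Finally, components and cocomponents
  of a poset in \<open>class_P\<close> are again in \<open>class_P\<close>, and a connected one is a point or of one of these two
  forms.\<close>

section \<open>Tutte polynomials of sums\<close>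

lemma order_ideal_empty: "order_ideal P {}"
  by (simp add: order_ideal_def)

text \<open>The empty ideal and the finiteness of \<open>S\<close> make the maximum in
  \<open>ideal_rank\<close> one over a finite nonempty set.\<close>

lemma
  assumes "finite S"
  shows ideal_rank_attained: "\<exists>I\<subseteq>S. order_ideal P I \<and> card I = ideal_rank P S"
    and ideal_rank_ge: "\<And>I. I \<subseteq> S \<Longrightarrow> order_ideal P I \<Longrightarrow> card I \<le> ideal_rank P S"
proof -
  let ?R = "{card I | I. I \<subseteq> S \<and> order_ideal P I}"
  have fin: "finite ?R"
    by (rule finite_subset[of _ "card ` Pow S"]) (use assms in auto)
  have "?R \<noteq> {}" using order_ideal_empty[of P] by auto
  from Max_in[OF fin this] show "\<exists>I\<subseteq>S. order_ideal P I \<and> card I = ideal_rank P S"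
    unfolding ideal_rank_def by auto
  show "card I \<le> ideal_rank P S" if "I \<subseteq> S" "order_ideal P I" for I
    unfolding ideal_rank_def using fin that by (intro Max_ge) auto
qed

lemma ideal_rank_le_card: "finite S \<Longrightarrow> ideal_rank P S \<le> card S"
  using ideal_rank_attained[of S P] by (auto dest: card_mono)

lemma ideal_rank_eqI:
  assumes "finite S" "I \<subseteq> S" "order_ideal P I" "card I = r"
    and "\<And>J. J \<subseteq> S \<Longrightarrow> order_ideal P J \<Longrightarrow> card J \<le> r"
  shows "ideal_rank P S = r"
proof (rule antisym)
  show "ideal_rank P S \<le> r" using ideal_rank_attained[OF assms(1), of P] assms(5) by metis
  show "r \<le> ideal_rank P S" using ideal_rank_ge[OF assms(1-3)] assms(4) by simp
qed

lemma ideal_rank_Field: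
  assumes "finite (Field P)"
  shows "ideal_rank P (Field P) = card (Field P)"
proof (rule ideal_rank_eqI)
  show "order_ideal P (Field P)" by (simp add: order_ideal_def)
  show "card J \<le> card (Field P)" if "J \<subseteq> Field P" for J
    using assms that by (rule card_mono)
qed (use assms in simp_all)

lemma in_Field: "(a, b) \<in> r \<Longrightarrow> a \<in> Field r \<and> b \<in> Field r"
  by (simp add: FieldI1 FieldI2)

lemma order_idealD: "order_ideal P I \<Longrightarrow> u \<in> I \<Longrightarrow> (v, u) \<in> P \<Longrightarrow> v \<in> I"
  unfolding order_ideal_def by (blast dest: in_Field)

lemma order_idealI:
  "I \<subseteq> Field P \<Longrightarrow> (\<And>u v. u \<in> I \<Longrightarrow> (v, u) \<in> P \<Longrightarrow> v \<in> I) \<Longrightarrow> order_ideal P I"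
  unfolding order_ideal_def by blast

lemma order_ideal_subset: "order_ideal P I \<Longrightarrow> I \<subseteq> Field P"
  by (simp add: order_ideal_def)

lemma in_direct_sum: "(v, u) \<in> direct_sum P Q \<longleftrightarrow> (v, u) \<in> P \<or> (v, u) \<in> Q"
  by (simp add: direct_sum_def)

lemma in_ordinal_sum:
  "(v, u) \<in> ordinal_sum P Q \<longleftrightarrow> (v, u) \<in> P \<or> (v, u) \<in> Q \<or> v \<in> Field P \<and> u \<in> Field Q"
  by (auto simp: ordinal_sum_def)

lemma order_ideal_direct_sum:
  "order_ideal (direct_sum P Q) I \<longleftrightarrow>
    I \<subseteq> Field P \<union> Field Q \<and> order_ideal P (I \<inter> Field P) \<and> order_ideal Q (I \<inter> Field Q)"
    (is "?L \<longleftrightarrow> ?R")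
proof (intro iffI conjI)
  assume L: ?L
  show "I \<subseteq> Field P \<union> Field Q" using order_ideal_subset[OF L] by (simp add: Field_direct_sum)
  have "v \<in> I" if "u \<in> I" "(v, u) \<in> P \<or> (v, u) \<in> Q" for u v
    using order_idealD[OF L that(1)] that(2) by (simp add: in_direct_sum)
  then show "order_ideal P (I \<inter> Field P)" "order_ideal Q (I \<inter> Field Q)"
    by (intro order_idealI; blast dest: in_Field)+
next
  assume R: ?R
  show ?L
  proof (rule order_idealI)
    show "I \<subseteq> Field (direct_sum P Q)" using R by (simp add: Field_direct_sum)
    fix u v assume u: "u \<in> I" and "(v, u) \<in> direct_sum P Q"
    then consider "(v, u) \<in> P" | "(v, u) \<in> Q" by (auto simp: in_direct_sum)
    then show "v \<in> I"
    proof cases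
      case 1
      then show ?thesis using order_idealD[of P "I \<inter> Field P" u v] R u in_Field[of v u P] by blast
    next
      case 2
      then show ?thesis using order_idealD[of Q "I \<inter> Field Q" u v] R u in_Field[of v u Q] by blast
    qed
  qed
qed

section \<open>Multiplicativity over direct sums\<close>

lemma card_Int_split:
  assumes "finite S" "S \<subseteq> A \<union> B" "A \<inter> B = {}"
  shows "card S = card (S \<inter> A) + card (S \<inter> B)"
proof -
  have "S = S \<inter> A \<union> S \<inter> B" using assms by auto
  then show ?thesis using assms card_Un_disjoint[of "S \<inter> A" "S \<inter> B"] by auto
qed

text \<open>Ideals of the two summands are chosen independently, so a largest one is the union of a
  largest ideal in each.\<close>

lemma ideal_rank_direct_sum:
  assumes "finite (Field P)" "finite (Field Q)" and disj: "Field P \<inter> Field Q = {}"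
    and S: "S \<subseteq> Field P" "T \<subseteq> Field Q"
  shows "ideal_rank (direct_sum P Q) (S \<union> T) = ideal_rank P S + ideal_rank Q T"
proof -
  have fin: "finite S" "finite T"
    using assms(1,2) finite_subset[OF S(1)] finite_subset[OF S(2)] by auto
  obtain I where I: "I \<subseteq> S" "order_ideal P I" "card I = ideal_rank P S"
    using ideal_rank_attained[OF fin(1)] by blast
  obtain J where J: "J \<subseteq> T" "order_ideal Q J" "card J = ideal_rank Q T"
    using ideal_rank_attained[OF fin(2)] by blast
  show ?thesis
  proof (rule ideal_rank_eqI)
    show "I \<union> J \<subseteq> S \<union> T" using I J by auto
    have "(I \<union> J) \<inter> Field P = I" "(I \<union> J) \<inter> Field Q = J" using I J S disj by auto
    then show "order_ideal (direct_sum P Q) (I \<union> J)"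
      unfolding order_ideal_direct_sum using I J S by auto
    have "I \<inter> J = {}" using I(1) J(1) S disj by blast
    then show "card (I \<union> J) = ideal_rank P S + ideal_rank Q T"
      using I J fin by (simp add: card_Un_disjoint finite_subset[of I] finite_subset[of J])
  next
    fix K assume K: "K \<subseteq> S \<union> T" "order_ideal (direct_sum P Q) K"
    then have "card K = card (K \<inter> Field P) + card (K \<inter> Field Q)"
      using S disj finite_subset[OF K(1)] fin K(1) by (intro card_Int_split) auto
    moreover have "K \<inter> Field P \<subseteq> S" "K \<inter> Field Q \<subseteq> T" using K S disj by auto
    ultimately show "card K \<le> ideal_rank P S + ideal_rank Q T"
      using K(2) fin unfolding order_ideal_direct_sum by (simp add: add_mono ideal_rank_ge)
  qed (use fin in auto)
qed

lemma sum_Pow_Un_disjoint: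
  assumes "A \<inter> B = {}"
  shows "(\<Sum>S\<in>Pow (A \<union> B). f S) = (\<Sum>S\<in>Pow A. \<Sum>T\<in>Pow B. f (S \<union> T))"
proof -
  have eq: "S \<inter> A \<union> S \<inter> B = S" if "S \<in> Pow (A \<union> B)" for S
    using that by auto
  have "(\<Sum>S\<in>Pow (A \<union> B). f S) = (\<Sum>(S, T)\<in>Pow A \<times> Pow B. f (S \<union> T))"
  proof (rule sum.reindex_bij_witness
      [where i = "\<lambda>(S, T). S \<union> T" and j = "\<lambda>S. (S \<inter> A, S \<inter> B)"])
    fix p assume p: "p \<in> Pow A \<times> Pow B"
    show "((case p of (S, T) \<Rightarrow> S \<union> T) \<inter> A, (case p of (S, T) \<Rightarrow> S \<union> T) \<inter> B) = p"
      using p assms by (cases p) auto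
    show "(case p of (S, T) \<Rightarrow> S \<union> T) \<in> Pow (A \<union> B)"
      using p by (cases p) auto
  qed (simp_all add: eq)
  then show ?thesis by (simp add: sum.cartesian_product)
qed

lemma tutte_direct_sum:
  assumes "finite (Field P)" "finite (Field Q)" and disj: "Field P \<inter> Field Q = {}"
  shows "tutte (direct_sum P Q) = tutte P * tutte Q"
proof -
  let ?f = "\<lambda>P S. (var_x - 1) ^ (card (Field P) - ideal_rank P S) *
    (var_y - 1) ^ (card S - ideal_rank P S)"
  have eq: "?f (direct_sum P Q) (S \<union> T) = ?f P S * ?f Q T"
    if S: "S \<subseteq> Field P" and T: "T \<subseteq> Field Q" for S T
  proof -
    have fin: "finite S" "finite T"
      using assms(1,2) finite_subset[OF S] finite_subset[OF T] by auto
    have "S \<inter> T = {}" using S T disj by auto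
    then have c: "card (S \<union> T) = card S + card T"
      "card (Field (direct_sum P Q)) = card (Field P) + card (Field Q)"
      using fin assms by (auto simp: Field_direct_sum card_Un_disjoint)
    \<comment> \<open>These bounds keep the subtractions of natural numbers from truncating, so both
      exponents split as sums.\<close>
    have "ideal_rank P S \<le> card S" "ideal_rank Q T \<le> card T"
      "card S \<le> card (Field P)" "card T \<le> card (Field Q)"
      using assms fin S T by (auto simp: ideal_rank_le_card card_mono)
    then have "card (Field P) + card (Field Q) - (ideal_rank P S + ideal_rank Q T)
        = (card (Field P) - ideal_rank P S) + (card (Field Q) - ideal_rank Q T)"
      "card S + card T - (ideal_rank P S + ideal_rank Q T)
        = (card S - ideal_rank P S) + (card T - ideal_rank Q T)" by linarith+
    then show ?thesis
      unfolding ideal_rank_direct_sum[OF assms S T] c by (simp only: power_add mult_ac)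
  qed
  have "tutte (direct_sum P Q) =
      (\<Sum>S\<in>Pow (Field P). \<Sum>T\<in>Pow (Field Q). ?f (direct_sum P Q) (S \<union> T))"
    unfolding tutte_def Field_direct_sum[of P Q] sum_Pow_Un_disjoint[OF disj] ..
  also have "\<dots> = (\<Sum>S\<in>Pow (Field P). \<Sum>T\<in>Pow (Field Q). ?f P S * ?f Q T)"
    using eq by (intro sum.cong) auto
  also have "\<dots> = tutte P * tutte Q"
    by (simp add: tutte_def sum_product)
  finally show ?thesis .
qed

section \<open>Ordinal sums\<close>

lemma order_ideal_ordinal_sum:
  assumes disj: "Field P \<inter> Field Q = {}"
  shows "order_ideal (ordinal_sum P Q) I \<longleftrightarrow>
    order_ideal P I \<or> (Field P \<subseteq> I \<and> I \<subseteq> Field P \<union> Field Q \<and> order_ideal Q (I \<inter> Field Q))"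
    (is "?L \<longleftrightarrow> ?R")
proof
  assume L: ?L
  have sub: "I \<subseteq> Field P \<union> Field Q"
    using order_ideal_subset[OF L] by (simp add: Field_ordinal_sum)
  have down: "v \<in> I" if "u \<in> I" "(v, u) \<in> P \<or> (v, u) \<in> Q \<or> v \<in> Field P \<and> u \<in> Field Q" for u v
    using order_idealD[OF L that(1)] that(2) by (simp add: in_ordinal_sum)
  show ?R
  proof (cases "I \<subseteq> Field P")
    case True
    then have "order_ideal P I" using down by (intro order_idealI) blast+
    then show ?thesis ..
  next
    case False
    then obtain q where q: "q \<in> I" "q \<in> Field Q" using sub by blast
    \<comment> \<open>A single element of \<open>I\<close> in the upper summand forces everything
      below it, hence all of \<open>P\<close>, into \<open>I\<close>.\<close>
    then have "Field P \<subseteq> I" using down by blast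
    moreover have "order_ideal Q (I \<inter> Field Q)"
      using down by (intro order_idealI) (blast dest: in_Field)+
    ultimately show ?thesis using sub by blast
  qed
next
  assume ?R
  then show ?L
  proof
    assume I: "order_ideal P I"
    note sub = order_ideal_subset[OF I]
    show ?L
    proof (rule order_idealI)
      show "I \<subseteq> Field (ordinal_sum P Q)" using sub by (auto simp: Field_ordinal_sum)
      fix u v assume u: "u \<in> I" and uv: "(v, u) \<in> ordinal_sum P Q"
      have "u \<notin> Field Q" using u sub disj by blast
      then have "(v, u) \<in> P" using uv in_Field[of v u Q] by (auto simp: in_ordinal_sum)
      then show "v \<in> I" by (rule order_idealD[OF I u])
    qed
  next
    assume R: "Field P \<subseteq> I \<and> I \<subseteq> Field P \<union> Field Q \<and> order_ideal Q (I \<inter> Field Q)"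
    show ?L
    proof (rule order_idealI)
      show "I \<subseteq> Field (ordinal_sum P Q)" using R by (simp add: Field_ordinal_sum)
      fix u v assume u: "u \<in> I" and uv: "(v, u) \<in> ordinal_sum P Q"
      show "v \<in> I"
      proof (cases "v \<in> Field P")
        case False
        then have "(v, u) \<in> Q" using uv in_Field[of v u P] by (auto simp: in_ordinal_sum)
        then show ?thesis
          using order_idealD[of Q "I \<inter> Field Q" u v] R u in_Field[of v u Q] by blast
      qed (use R in blast)
    qed
  qed
qed

text \<open>If \<open>S\<close> misses a point of \<open>P\<close>, no ideal inside
  \<open>S \<union> T\<close> contains \<open>Field P\<close>, so none can use points of
  \<open>T\<close>. If \<open>S\<close> is all of \<open>P\<close>, it is completed by a largest
  ideal of \<open>Q\<close> inside \<open>T\<close>.\<close>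

lemma ideal_rank_ordinal_sum:
  assumes "finite (Field P)" "finite (Field Q)" and disj: "Field P \<inter> Field Q = {}"
    and S: "S \<subseteq> Field P" "T \<subseteq> Field Q"
  shows "ideal_rank (ordinal_sum P Q) (S \<union> T) =
    (if S = Field P then card (Field P) + ideal_rank Q T else ideal_rank P S)"
proof -
  have fin: "finite S" "finite T"
    using assms(1,2) finite_subset[OF S(1)] finite_subset[OF S(2)] by auto
  show ?thesis
  proof (cases "S = Field P")
    case True
    obtain J where J: "J \<subseteq> T" "order_ideal Q J" "card J = ideal_rank Q T"
      using ideal_rank_attained[OF fin(2)] by blast
    have "ideal_rank (ordinal_sum P Q) (S \<union> T) = card (Field P) + ideal_rank Q T"
    proof (rule ideal_rank_eqI)
      show "Field P \<union> J \<subseteq> S \<union> T" using J True by auto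
      have "(Field P \<union> J) \<inter> Field Q = J" using J S disj by auto
      then show "order_ideal (ordinal_sum P Q) (Field P \<union> J)"
        unfolding order_ideal_ordinal_sum[OF disj] using J S by auto
      have "Field P \<inter> J = {}" using J(1) S disj by blast
      then show "card (Field P \<union> J) = card (Field P) + ideal_rank Q T"
        using J fin assms by (simp add: card_Un_disjoint finite_subset)
    next
      fix K assume K: "K \<subseteq> S \<union> T" "order_ideal (ordinal_sum P Q) K"
      have "card K = card (K \<inter> Field P) + card (K \<inter> Field Q)"
        using S disj finite_subset[OF K(1)] fin K(1) by (intro card_Int_split) auto
      moreover have "card (K \<inter> Field P) \<le> card (Field P)" using assms by (simp add: card_mono)
      moreover have "card (K \<inter> Field Q) \<le> ideal_rank Q T"
      proof (rule ideal_rank_ge[OF fin(2)])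
        show "K \<inter> Field Q \<subseteq> T" using K S disj by auto
        show "order_ideal Q (K \<inter> Field Q)"
        \<comment> \<open>The first kind of ideal in \<open>order_ideal_ordinal_sum\<close> lies
          inside \<open>P\<close>, so its trace on \<open>Q\<close> is empty.\<close>
        proof (cases "order_ideal P K")
          case True
          then have "K \<inter> Field Q = {}" using disj by (auto simp: order_ideal_def)
          then show ?thesis by (simp add: order_ideal_empty)
        next
          case False
          then show ?thesis using K(2) unfolding order_ideal_ordinal_sum[OF disj] by blast
        qed
      qed
      ultimately show "card K \<le> card (Field P) + ideal_rank Q T" by linarith
    qed (use fin in auto)
    then show ?thesis using True by simp
  next
    case False
    obtain I where I: "I \<subseteq> S" "order_ideal P I" "card I = ideal_rank P S"
      using ideal_rank_attained[OF fin(1)] by blast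
    have "ideal_rank (ordinal_sum P Q) (S \<union> T) = ideal_rank P S"
    proof (rule ideal_rank_eqI)
      show "I \<subseteq> S \<union> T" using I by auto
      show "order_ideal (ordinal_sum P Q) I"
        unfolding order_ideal_ordinal_sum[OF disj] using I by auto
    next
      fix K assume K: "K \<subseteq> S \<union> T" "order_ideal (ordinal_sum P Q) K"
      have "\<not> Field P \<subseteq> K" using K(1) False S disj by blast
      then have "order_ideal P K" using K(2) unfolding order_ideal_ordinal_sum[OF disj] by blast
      moreover from this have "K \<subseteq> S"
        using K(1) S disj unfolding order_ideal_def by blast
      ultimately show "card K \<le> ideal_rank P S" using fin by (simp add: ideal_rank_ge)
    qed (use I fin in auto)
    then show ?thesis using False by simp
  qed
qed

text \<open>Each point is independently in or out of \<open>S\<close>. At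
  \<open>a = var_y - 1\<close> this turns a free choice of subset into a power of
  \<open>var_y\<close>.\<close>

lemma sum_Pow_power_card:
  assumes "finite A"
  shows "(\<Sum>S\<in>Pow A. a ^ card S) = (1 + a :: 'a :: comm_semiring_1) ^ card A"
  using assms
proof induction
  case (insert x A)
  have "(\<Sum>S\<in>Pow (A \<union> {x}). a ^ card S) = (\<Sum>S\<in>Pow A. \<Sum>T\<in>Pow {x}. a ^ card (S \<union> T))"
    using insert by (intro sum_Pow_Un_disjoint) auto
  also have "\<dots> = (\<Sum>S\<in>Pow A. a ^ card S + a * a ^ card S)"
  proof (intro sum.cong refl)
    fix S assume "S \<in> Pow A"
    then have "x \<notin> S" "finite S" using insert by (auto intro: finite_subset)
    then show "(\<Sum>T\<in>Pow {x}. a ^ card (S \<union> T)) = a ^ card S + a * a ^ card S"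
      by (simp add: Pow_insert add.commute)
  qed
  also have "\<dots> = (1 + a) * (1 + a) ^ card A"
    unfolding insert.IH[symmetric] by (simp add: sum.distrib sum_distrib_left algebra_simps)
  finally show ?case using insert by simp
qed simp

text \<open>Subsets containing all of \<open>P\<close> contribute \<open>tutte Q\<close>. For every
  other trace \<open>S\<close> on \<open>P\<close> the rank does not depend on \<open>T\<close>, so
  summing over \<open>T\<close> yields a power of \<open>var_y\<close>; the full set, whose summand
  in \<open>tutte P\<close> is 1, is missing there, which explains
  \<open>tutte P - 1\<close>.\<close>

lemma tutte_ordinal_sum:
  assumes "finite (Field P)" "finite (Field Q)" and disj: "Field P \<inter> Field Q = {}"
  shows "tutte (ordinal_sum P Q) =
    tutte Q + ((var_x - 1) * var_y) ^ card (Field Q) * (tutte P - 1)"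
proof -
  let ?f = "\<lambda>P S. (var_x - 1) ^ (card (Field P) - ideal_rank P S) *
    (var_y - 1) ^ (card S - ideal_rank P S)"
  let ?q = "card (Field Q)"
  have c: "card (Field (ordinal_sum P Q)) = card (Field P) + ?q"
    using assms by (simp add: Field_ordinal_sum card_Un_disjoint)
  have full: "?f (ordinal_sum P Q) (Field P \<union> T) = ?f Q T" if T: "T \<subseteq> Field Q" for T
  proof -
    have "card (Field P \<union> T) = card (Field P) + card T"
      using T assms by (meson card_Un_disjoint disjoint_iff finite_subset subsetD)
    then show ?thesis
      unfolding ideal_rank_ordinal_sum[OF assms order_refl T] c by simp
  qed
  have proper: "?f (ordinal_sum P Q) (S \<union> T) = (var_x - 1) ^ ?q * ?f P S * (var_y - 1) ^ card T"
    if S: "S \<subseteq> Field P" "S \<noteq> Field P" and T: "T \<subseteq> Field Q" for S T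
  proof -
    have fin: "finite S" "finite T"
      using assms(1,2) finite_subset[OF S(1)] finite_subset[OF T] by auto
    have le: "ideal_rank P S \<le> card S" "card S \<le> card (Field P)"
      using assms fin S by (auto simp: ideal_rank_le_card card_mono)
    have "S \<inter> T = {}" using S T disj by auto
    then have "card (S \<union> T) = card S + card T" using fin by (simp add: card_Un_disjoint)
    moreover have "card (Field P) + ?q - ideal_rank P S = ?q + (card (Field P) - ideal_rank P S)"
      "card S + card T - ideal_rank P S = (card S - ideal_rank P S) + card T"
      using le by linarith+
    ultimately show ?thesis
      unfolding ideal_rank_ordinal_sum[OF assms S(1) T] c
      using S(2) by (simp only: if_False power_add mult_ac)
  qed
  have one: "?f P (Field P) = 1" using assms by (simp add: ideal_rank_Field)
  let ?A = "Pow (Field P) - {Field P}"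
  have "tutte (ordinal_sum P Q) =
      (\<Sum>S\<in>Pow (Field P). \<Sum>T\<in>Pow (Field Q). ?f (ordinal_sum P Q) (S \<union> T))"
    unfolding tutte_def Field_ordinal_sum[of P Q] sum_Pow_Un_disjoint[OF disj] ..
  also have "\<dots> = (\<Sum>T\<in>Pow (Field Q). ?f (ordinal_sum P Q) (Field P \<union> T)) +
      (\<Sum>S\<in>?A. \<Sum>T\<in>Pow (Field Q). ?f (ordinal_sum P Q) (S \<union> T))"
    using assms by (subst sum.remove[of _ "Field P"]) auto
  also have "(\<Sum>T\<in>Pow (Field Q). ?f (ordinal_sum P Q) (Field P \<union> T)) = tutte Q"
    unfolding tutte_def using full by (intro sum.cong) auto
  also have "(\<Sum>S\<in>?A. \<Sum>T\<in>Pow (Field Q). ?f (ordinal_sum P Q) (S \<union> T)) =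
      (\<Sum>S\<in>?A. \<Sum>T\<in>Pow (Field Q). (var_x - 1) ^ ?q * ?f P S * (var_y - 1) ^ card T)"
    using proper by (intro sum.cong) auto
  also have "\<dots> = ((var_x - 1) * var_y) ^ ?q * (\<Sum>S\<in>?A. ?f P S)"
    unfolding sum_distrib_left[symmetric] sum_distrib_right[symmetric]
      sum_Pow_power_card[OF assms(2)]
    by (simp add: power_mult_distrib)
  also have "(\<Sum>S\<in>?A. ?f P S) = tutte P - 1"
    unfolding tutte_def using assms one by (simp add: sum_diff1)
  finally show ?thesis .
qed

section \<open>Points and antichains\<close>

lemma Field_one: "Field {(a, a)} = {a}"
  by (auto simp: Field_def)

lemma tutte_one: "tutte {(a, a)} = var_x"
proof -
  have "ideal_rank {(a, a)} {} = 0" using ideal_rank_le_card[of "{}"] by simp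
  moreover have "ideal_rank {(a, a)} {a} = 1" using ideal_rank_Field[of "{(a, a)}"] by (simp add: Field_one)
  ultimately show ?thesis
    unfolding tutte_def Field_one by (simp add: Pow_insert)
qed

lemma Field_Id_on [simp]: "Field (Id_on A) = A"
  by (auto simp: Field_def)

lemma Id_on_insert: "Id_on (insert a A) = direct_sum {(a, a)} (Id_on A)"
  by (auto simp: direct_sum_def)

lemma tutte_antichain: "finite A \<Longrightarrow> tutte (Id_on A) = var_x ^ card A"
proof (induction A rule: finite_induct)
  case empty
  then show ?case using ideal_rank_le_card[of "{}" "{}"] by (simp add: tutte_def)
next
  case (insert a A)
  then show ?case
    unfolding Id_on_insert by (subst tutte_direct_sum) (auto simp: tutte_one Field_one)
qed

section \<open>Irreducibility in \<open>\<rat>[x][u]\<close>\<close>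

locale unital_ring_hom =
  fixes h :: "'a :: comm_ring_1 \<Rightarrow> 'b :: comm_ring_1"
  assumes hom_add: "h (a + b) = h a + h b"
    and hom_mult: "h (a * b) = h a * h b"
    and hom_1: "h 1 = 1"
begin

lemma hom_0: "h 0 = 0"
  using hom_add[of 0 0] by simp

lemma hom_diff: "h (a - b) = h a - h b"
  using hom_add[of "a - b" b] by (simp add: algebra_simps)

lemma hom_power: "h (a ^ n) = h a ^ n"
  by (induction n) (simp_all add: hom_1 hom_mult)

lemma hom_dvd: "a dvd b \<Longrightarrow> h a dvd h b"
  by (auto simp: hom_mult)

lemma poly_map_poly_pCons: "poly (map_poly h (pCons a p)) v = h a + v * poly (map_poly h p) v"
  by (simp add: map_poly_pCons hom_0)

text \<open>Mapping coefficients by \<open>h\<close> and then evaluating is multiplicative by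
  induction on the first factor. Two applications yield \<open>twist\<close>: one for the
  coefficients in x, one for the polynomials in u.\<close>

lemma unital_ring_hom_poly: "unital_ring_hom (\<lambda>p. poly (map_poly h p) v)"
proof
  fix p q
  let ?e = "\<lambda>p. poly (map_poly h p) v"
  show add: "?e (p + q) = ?e p + ?e q" for p q
  proof -
    have "map_poly h (p + q) = map_poly h p + map_poly h q"
      by (rule poly_eqI) (simp add: coeff_map_poly hom_0 hom_add)
    then show ?thesis by simp
  qed
  have smult: "?e (smult a p) = h a * ?e p" for a p
  proof -
    have "map_poly h (smult a p) = smult (h a) (map_poly h p)"
      by (rule poly_eqI) (simp add: coeff_map_poly hom_0 hom_mult)
    then show ?thesis by simp
  qed
  show "?e (p * q) = ?e p * ?e q"
    by (induction p)
      (simp_all add: add smult poly_map_poly_pCons hom_0 algebra_simps)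
  show "?e 1 = 1" by (simp add: map_poly_1 hom_1)
qed

end

text \<open>Reduction of the coefficients modulo the prime \<open>x - 1\<close>, the residue map of
  both Eisenstein arguments; the inner variable is x and the outer one is u.\<close>

definition at_one :: "rat poly poly \<Rightarrow> rat poly" where
  "at_one = map_poly (\<lambda>c. poly c 1)"

lemma coeff_at_one [simp]: "coeff (at_one p) i = poly (coeff p i) 1"
  by (simp add: at_one_def coeff_map_poly)

interpretation at_one: unital_ring_hom at_one
  by unfold_locales (rule poly_eqI; simp add: coeff_mult poly_sum coeff_1)+

lemma at_one_monom [simp]: "at_one (monom c n) = monom (poly c 1) n"
  by (rule poly_eqI) simp

text \<open>The substitution \<open>B(u, x) \<mapsto> B(u, x u)\<close> on \<open>\<rat>[x][u]\<close>.\<close>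

definition twist_coeff :: "rat poly \<Rightarrow> rat poly poly" where
  "twist_coeff c = poly (map_poly (\<lambda>q. [:[:q:]:]) c) (monom [:0, 1:] 1)"

definition twist :: "rat poly poly \<Rightarrow> rat poly poly" where
  "twist p = poly (map_poly twist_coeff p) [:0, 1:]"

interpretation const_const: unital_ring_hom "\<lambda>q :: rat. [:[:q:]:]"
  by unfold_locales (simp_all add: one_pCons)

interpretation twist_coeff: unital_ring_hom twist_coeff
  unfolding twist_coeff_def by (rule const_const.unital_ring_hom_poly)

interpretation twist: unital_ring_hom twist
  unfolding twist_def by (rule twist_coeff.unital_ring_hom_poly)

lemma coeff_twist_coeff: "coeff (coeff (twist_coeff c) n) j = (if j = n then coeff c j else 0)"
proof (induction c arbitrary: n j)
  case 0
  then show ?case by (simp add: twist_coeff.hom_0)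
next
  case (pCons a p)
  have "twist_coeff (pCons a p) = [:[:a:]:] + monom [:0, 1:] 1 * twist_coeff p"
    unfolding twist_coeff_def by (rule const_const.poly_map_poly_pCons)
  then show ?case
    by (cases n; cases j) (auto simp: coeff_monom_mult pCons.IH coeff_pCons split: nat.splits)
qed

text \<open>The monomial x^j u^i goes to x^j u^(i + j), so no coefficient is lost and a polynomial
  can be recovered from its image.\<close>

lemma coeff_twist: "coeff (coeff (twist p) n) j = (if j \<le> n then coeff (coeff p (n - j)) j else 0)"
proof (induction p arbitrary: n j)
  case 0
  then show ?case by (simp add: twist.hom_0)
next
  case (pCons a p)
  have "twist (pCons a p) = twist_coeff a + [:0, 1:] * twist p"
    unfolding twist_def by (rule twist_coeff.poly_map_poly_pCons)
  then show ?case
    by (cases n; cases "j \<le> n")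
      (auto simp: coeff_twist_coeff pCons.IH coeff_pCons Suc_diff_le split: nat.splits)
qed

lemma twist_monom_one: "twist (monom 1 n) = monom 1 n"
proof -
  have "twist [:0, 1:] = [:0, 1:]"
    unfolding twist_def
    by (simp add: map_poly_pCons twist_coeff.hom_0 twist_coeff.hom_1)
  then show ?thesis using twist.hom_power[of "[:0, 1:]" n] by (simp add: monom_altdef)
qed

lemma twist_const_power: "twist [:[:0, 1:] ^ n:] = monom ([:0, 1:] ^ n) n"
proof -
  have "twist [:[:0, 1:]:] = monom [:0, 1:] 1"
    unfolding twist_def twist_coeff_def
    by (simp add: map_poly_pCons twist_coeff.hom_0 smult_monom)
  moreover have "[:[:0, 1:] ^ n:] = ([:[:0, 1:]:] :: rat poly poly) ^ n"
    by (simp add: poly_const_pow)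
  ultimately show ?thesis by (simp add: twist.hom_power monom_power)
qed

section \<open>Factors of powers of the variable\<close>

lemma order_eq_degree_of_mult_eq_monom:
  fixes p q :: "'a :: idom poly"
  assumes "p * q = monom 1 m"
  shows "order 0 p = degree p"
proof -
  have nz: "p * q \<noteq> 0" using assms by simp
  then have "p \<noteq> 0" "q \<noteq> 0" by auto
  have "order 0 p + order 0 q = m" using order_mult[OF nz, of 0] assms by (simp add: order_0_monom)
  moreover have "degree p + degree q = m"
    using degree_mult_eq[OF \<open>p \<noteq> 0\<close> \<open>q \<noteq> 0\<close>] assms by (simp add: degree_monom_eq)
  \<comment> \<open>Orders at 0 and degrees both add up to \<open>m\<close>, so these inequalities
    must be equalities.\<close>
  moreover have "order 0 p \<le> degree p" "order 0 q \<le> degree q"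
    using \<open>p \<noteq> 0\<close> \<open>q \<noteq> 0\<close> by (simp_all add: order_degree)
  ultimately show ?thesis by linarith
qed

text \<open>The zero of \<open>p\<close> at 0 has multiplicity \<open>degree p\<close>, so a power
  of the variable splits off and leaves a constant; the leading coefficients multiply to 1, so that
  constant is a unit.\<close>

lemma monom_of_mult_eq_monom:
  fixes p q :: "'a :: idom poly"
  assumes "p * q = monom 1 m"
  shows "\<exists>c. p = monom c (degree p) \<and> c dvd 1"
proof -
  have "p \<noteq> 0" "q \<noteq> 0" using assms by auto
  obtain r where r: "p = monom 1 (degree p) * r"
    using order_1[of 0 p] order_eq_degree_of_mult_eq_monom[OF assms]
    by (auto simp: monom_altdef elim: dvdE)
  then have "r \<noteq> 0" using \<open>p \<noteq> 0\<close> by auto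
  then have "degree p = degree p + degree r"
    using degree_mult_eq[of "monom 1 (degree p)" r] r by (simp add: degree_monom_eq)
  then obtain c where "r = [:c:]" by (metis add_cancel_right_right degree_eq_zeroE)
  then have p: "p = monom c (degree p)"
    using r by (simp add: smult_monom mult.commute)
  have "lead_coeff p * lead_coeff q = 1"
    using assms lead_coeff_mult[of p q] by (simp add: degree_monom_eq)
  moreover have "lead_coeff p = c" using p by (metis coeff_monom)
  ultimately have "c dvd 1" by (metis dvd_triv_left)
  then show ?thesis using p by blast
qed

section \<open>Eisenstein criteria\<close>

lemma irreducible_polyI:
  fixes F :: "'a :: idom poly"
  assumes "F \<noteq> 0" "degree F > 0"
    and content: "\<And>d. (\<And>i. d dvd coeff F i) \<Longrightarrow> d dvd 1"
    and "\<And>f g. F = f * g \<Longrightarrow> degree f > 0 \<Longrightarrow> degree g > 0 \<Longrightarrow> False"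
  shows "irreducible F"
proof (rule irreducibleI)
  show "F \<noteq> 0" by fact
  show "\<not> F dvd 1" using assms(2) by (auto simp: is_unit_poly_iff)
  fix f g assume F: "F = f * g"
  have unit: "f dvd 1" if F: "F = f * g" and deg: "degree f = 0" for f g
  proof -
    obtain d where d: "f = [:d:]" using deg by (rule degree_eq_zeroE)
    \<comment> \<open>A factor of degree 0 divides every coefficient of \<open>F\<close>.\<close>
    have "d dvd 1" using F d by (intro content) simp
    then show ?thesis using d by (simp add: is_unit_const_poly_iff)
  qed
  show "f dvd 1 \<or> g dvd 1"
    using unit[OF F] unit[of g f] F assms(4)[OF F] by (auto simp: mult.commute)
qed

lemma pderiv_mult_at_root:
  "poly a r = 0 \<Longrightarrow> poly b r = 0 \<Longrightarrow> poly (pderiv (a * b)) r = 0"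
  by (simp add: pderiv_mult)

text \<open>Modulo \<open>x - 1\<close> the polynomial is a power of u and degrees cannot drop, so
  the reductions of two factors of positive degree both vanish at 0. The constant coefficient of
  \<open>F\<close> would then have a double zero at 1; \<open>simple\<close> excludes this and
  stands for the usual condition on the square of the prime.\<close>

lemma eisenstein:
  assumes at1: "at_one F = monom 1 (degree F)" and deg: "degree F > 0"
    and simple: "poly (pderiv (coeff F 0)) 1 \<noteq> 0"
    and content: "\<And>d. (\<And>i. d dvd coeff F i) \<Longrightarrow> d dvd 1"
  shows "irreducible F"
proof (rule irreducible_polyI)
  fix f g assume F: "F = f * g" and pos: "degree f > 0" "degree g > 0"
  have vanish: "poly (coeff f 0) 1 = 0" if "F = f * g" "degree f > 0" for f g
  proof -
    have m: "at_one f * at_one g = monom 1 (degree F)"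
      using at1 that(1) by (simp add: at_one.hom_mult)
    have "f \<noteq> 0" "g \<noteq> 0" using that deg by auto
    then have "degree F = degree f + degree g" using that(1) by (simp add: degree_mult_eq)
    moreover have "degree F = degree (at_one f) + degree (at_one g)"
    proof -
      have "at_one f * at_one g \<noteq> 0" using m by simp
      then have "degree (at_one f * at_one g) = degree (at_one f) + degree (at_one g)"
        by (intro degree_mult_eq) auto
      then show ?thesis using m by (simp add: degree_monom_eq)
    qed
    moreover have "degree (at_one p) \<le> degree p" for p
      by (rule degree_le) (simp add: coeff_eq_0)
    note le = this[of f] this[of g]
    \<comment> \<open>The reductions have total degree \<open>degree F\<close> and neither exceeds
      its factor in degree, so both degrees are preserved.\<close>
    ultimately have "degree (at_one f) = degree f" using le by linarith
    then have "order 0 (at_one f) > 0"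
      using order_eq_degree_of_mult_eq_monom[OF m] that(2) by simp
    then have "poly (at_one f) 0 = 0" by (simp add: order_root)
    then show ?thesis by (simp add: poly_0_coeff_0)
  qed
  have "poly (coeff f 0) 1 = 0" "poly (coeff g 0) 1 = 0"
    using vanish[OF F pos(1)] vanish[of g f] F pos(2) by (simp_all add: mult.commute)
  then show False using simple pderiv_mult_at_root unfolding F coeff_mult_0 by blast
qed (use assms in auto)

text \<open>The reduction of \<open>F\<close> is 1, so its factors reduce to constants. Each factor
  of positive degree then has a leading coefficient vanishing at 1, and two of them would give
  \<open>lead_coeff F\<close> a double zero there.\<close>

lemma reverse_eisenstein:
  assumes at1: "at_one F = 1" and deg: "degree F > 0"
    and simple: "poly (pderiv (lead_coeff F)) 1 \<noteq> 0"
    and content: "\<And>d. (\<And>i. d dvd coeff F i) \<Longrightarrow> d dvd 1"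
  shows "irreducible F"
proof (rule irreducible_polyI)
  fix f g assume F: "F = f * g" and pos: "degree f > 0" "degree g > 0"
  have vanish: "poly (lead_coeff f) 1 = 0" if "F = f * g" "degree f > 0" for f g
  proof -
    have "at_one f * at_one g = 1" using at1 that(1) by (simp add: at_one.hom_mult)
    then have "at_one f dvd 1" by (metis dvd_triv_left)
    then have "degree (at_one f) = 0" by (auto simp: is_unit_poly_iff)
    then have "coeff (at_one f) (degree f) = 0" using that(2) by (simp add: coeff_eq_0 del: coeff_at_one)
    then show ?thesis by simp
  qed
  have "poly (lead_coeff f) 1 = 0" "poly (lead_coeff g) 1 = 0"
    using vanish[OF F pos(1)] vanish[of g f] F pos(2) by (simp_all add: mult.commute)
  then show False using simple pderiv_mult_at_root unfolding F lead_coeff_mult by blast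
qed (use assms in auto)

text \<open>Modulo \<open>d\<close> the element \<open>(a ^ n) ^ k\<close> is 1 because
  \<open>a ^ n\<close> is, and 0 because \<open>a ^ k\<close> divides it. This supplies the
  primitivity required by both criteria.\<close>

lemma dvd_power_and_power_minus_one:
  fixes a d :: "'a :: comm_ring_1"
  assumes "d dvd a ^ k" "d dvd a ^ n - 1" "n > 0"
  shows "d dvd 1"
proof -
  have "a ^ n - 1 dvd (a ^ n) ^ k - 1"
    unfolding power_diff_1_eq[of "a ^ n" k] by (rule dvd_triv_left)
  then have "d dvd (a ^ n) ^ k - 1" by (rule dvd_trans[OF assms(2)])
  moreover have "a ^ k dvd (a ^ n) ^ k"
    using assms(3) by (simp add: power_mult[symmetric] le_imp_power_dvd)
  then have "d dvd (a ^ n) ^ k" by (rule dvd_trans[OF assms(1)])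
  ultimately have "d dvd (a ^ n) ^ k - ((a ^ n) ^ k - 1)" by (rule dvd_diff[rotated])
  then show ?thesis by simp
qed

text \<open>For \<open>n > 0\<close> the number 1 is a simple zero of x^n - 1, which is the
  derivative condition of both criteria.\<close>

lemma poly_pderiv_power_minus_one:
  "poly (pderiv ([:0, 1:] ^ n - 1 :: rat poly)) 1 = of_nat n"
  by (induction n) (simp_all add: pderiv_diff pderiv_mult pderiv_pCons)

text \<open>The prime \<open>E\<close> divides the image of one factor, so the image of the other
  divides a power of u and is a monomial with unit coefficient. Since \<open>coeff B 0\<close> is
  nonzero, u divides no factor of \<open>B\<close>, and that other factor is a unit.\<close>

lemma irreducible_of_twist:
  assumes tw: "twist B = monom 1 n * E" and E: "irreducible E" and B0: "coeff B 0 \<noteq> 0"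
  shows "irreducible B"
proof (rule irreducibleI)
  have E0: "E \<noteq> 0" and Eu: "\<not> E dvd 1" using E by (auto simp: irreducible_def)
  show "B \<noteq> 0" using B0 by auto
  show "\<not> B dvd 1"
  proof
    assume "B dvd 1"
    then have "twist B dvd 1" using twist.hom_dvd[of B 1] by (simp add: twist.hom_1)
    then have "E dvd 1" unfolding tw by (rule dvd_mult_right)
    then show False using Eu by simp
  qed
  fix f g assume B: "B = f * g"
  have unit: "g dvd 1" if B: "B = f * g" and dvd: "E dvd twist f" for f g
  proof -
    obtain e where e: "twist f = E * e" using dvd ..
    have "E * (twist g * e) = E * monom 1 n"
      using tw e unfolding B twist.hom_mult by (simp add: mult_ac)
    then have "twist g * e = monom 1 n" using E0 by simp
    then obtain c where c: "twist g = monom c (degree (twist g))" "c dvd 1"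
      using monom_of_mult_eq_monom by blast
    then obtain q where q: "c = [:q:]" "q dvd 1" by (auto simp: is_unit_poly_iff)
    let ?k = "degree (twist g)"
    \<comment> \<open>Undoing \<open>twist\<close> coefficient by coefficient: \<open>c\<close> is a
      rational constant, so only entries with \<open>j = 0\<close> survive.\<close>
    have co: "coeff (coeff g i) j = (if i + j = ?k \<and> j = 0 then q else 0)" for i j
    proof -
      have "coeff (coeff g i) j = coeff (coeff (twist g) (i + j)) j" by (simp add: coeff_twist)
      also have "\<dots> = coeff (coeff (monom c ?k) (i + j)) j" using c(1) by metis
      also have "\<dots> = (if i + j = ?k \<and> j = 0 then q else 0)"
        by (auto simp: q coeff_pCons split: nat.splits)
      finally show ?thesis .
    qed
    have g: "g = monom [:q:] ?k"
      by (intro poly_eqI) (auto simp: co coeff_pCons split: nat.splits)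
    moreover have "coeff g 0 \<noteq> 0" using B0 B by (auto simp: coeff_mult_0)
    ultimately have "?k = 0" by (metis coeff_monom)
    then have "g = [:[:q:]:]" using g by (simp add: monom_0)
    then show ?thesis using q(2) by (simp add: is_unit_const_poly_iff)
  qed
  \<comment> \<open>Irreducible elements are prime because the ring \<open>rat poly poly\<close> is
    factorial.\<close>
  have "prime_elem E" using E by (rule irreducible_imp_prime_poly)
  moreover have "E dvd twist f * twist g"
    using tw B by (simp add: twist.hom_mult)
  ultimately have "E dvd twist f \<or> E dvd twist g" by (simp add: prime_elem_dvd_mult_iff)
  then show "f dvd 1 \<or> g dvd 1"
    using unit[OF B] unit[of g f] B by (auto simp: mult.commute)
qed

text \<open>A factor \<open>f\<close> of \<open>B(c u)\<close> becomes a factor of a multiple of \<open>B\<close> after clearing the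
  denominators of \<open>f(u / c)\<close>.\<close>

lemma irreducible_pcompose_scale:
  fixes B :: "rat poly poly"
  assumes B: "irreducible B" "degree B > 0" and c: "c \<noteq> 0" "coprime (coeff B 0) c"
  shows "irreducible (pcompose B [:0, c:])"
proof (rule irreducibleI)
  have B0: "B \<noteq> 0" using B by auto
  let ?T = "pcompose B [:0, c:]"
  have degT: "degree ?T = degree B" using c by (simp add: degree_pcompose)
  then show T0: "?T \<noteq> 0" using B by auto
  show "\<not> ?T dvd 1" using degT B by (auto simp: is_unit_poly_iff)
  \<comment> \<open>\<open>S p\<close> is \<open>c ^ degree p\<close> times p(u / c), written
    without division.\<close>
  define S where "S p = (\<Sum>i\<le>degree p. monom (c ^ (degree p - i) * coeff p i) i)" for p
  have coeff_S: "coeff (S p) i = (if i \<le> degree p then c ^ (degree p - i) * coeff p i else 0)" for p i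
    by (simp add: S_def coeff_sum)
  have S: "pcompose (S p) [:0, c:] = smult (c ^ degree p) p" for p
  proof (rule poly_eqI)
    fix i
    show "coeff (pcompose (S p) [:0, c:]) i = coeff (smult (c ^ degree p) p) i"
    proof (cases "i \<le> degree p")
      case True
      then have "c ^ degree p = c ^ i * c ^ (degree p - i)"
        by (metis le_add_diff_inverse power_add)
      then show ?thesis using True by (simp add: coeff_pcompose_linear coeff_S mult.assoc)
    qed (simp add: coeff_pcompose_linear coeff_S coeff_eq_0)
  qed
  have unit: "g dvd 1" if T: "?T = f * g" and dvd: "B dvd S f" for f g
  proof -
    have nz: "f \<noteq> 0" "g \<noteq> 0" using T T0 by auto
    have "S f \<noteq> 0" 
    proof
      assume "S f = 0"
      then have "smult (c ^ degree f) f = 0" using S[of f] by simp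
      then show False using nz(1) c(1) by simp
    qed
    then have "degree B \<le> degree (S f)" using dvd dvd_imp_degree_le by blast
    also have "\<dots> \<le> degree f" by (rule degree_le) (simp add: coeff_S)
    \<comment> \<open>The factor \<open>f\<close> already has the full degree of the
      product.\<close>
    finally have "degree g = 0"
      using degT degree_mult_eq[OF nz] unfolding T by linarith
    then obtain d where d: "g = [:d:]" by (rule degree_eq_zeroE)
    have "d dvd c ^ i * coeff B i" for i
      using arg_cong[OF T, of "\<lambda>p. coeff p i"] d by (simp add: coeff_pcompose_linear)
    note dc = this
    \<comment> \<open>Scaling leaves the constant coefficient unchanged, so \<open>d\<close> divides
      it and is coprime to \<open>c\<close>; the powers of \<open>c\<close> can then be cancelled in
      the other coefficients.\<close>
    have "d dvd coeff B 0" using dc[of 0] by simp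
    then have "coprime d c" by (rule coprime_divisors[OF _ dvd_refl c(2)])
    then have "d dvd coeff B i" for i
      using dc[of i] by (simp add: coprime_dvd_mult_right_iff)
    then have "g dvd B" unfolding d by (simp add: const_poly_dvd_iff)
    then obtain e where e: "B = g * e" ..
    then have "g dvd 1 \<or> e dvd 1" using B(1) by (simp add: irreducible_def)
    moreover have "\<not> e dvd 1"
    proof
      assume "e dvd 1"
      then have "degree e = 0" by (auto simp: is_unit_poly_iff)
      moreover have "degree B \<le> degree g + degree e" unfolding e by (rule degree_mult_le)
      ultimately show False using B(2) unfolding d by simp
    qed
    ultimately show ?thesis by blast
  qed
  fix f g assume T: "?T = f * g"
  have "f \<noteq> 0" "g \<noteq> 0" using T T0 by auto
  then have deg: "degree f + degree g = degree B" 
    using degT unfolding T by (simp add: degree_mult_eq)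
  \<comment> \<open>The identity between \<open>S f * S g\<close> and a multiple of \<open>B\<close>
    is checked after scaling and pulled back, as composition with \<open>[:0, c:]\<close> is
    injective.\<close>
  have "pcompose (S f * S g - smult (c ^ degree B) B) [:0, c:] = 0"
    unfolding pcompose_diff pcompose_mult pcompose_smult S T deg[symmetric]
    by (simp add: power_add mult.commute)
  then have "S f * S g = smult (c ^ degree B) B"
    using c(1) by (simp add: pcompose_eq_0_iff)
  then have "B dvd S f * S g" by (simp add: dvd_smult)
  moreover have "prime_elem B" using B(1) by (rule irreducible_imp_prime_poly)
  ultimately have "B dvd S f \<or> B dvd S g" by (simp add: prime_elem_dvd_mult_iff)
  then show "f dvd 1 \<or> g dvd 1"
    using unit[OF T] unit[of g f] T by (auto simp: mult.commute)
qed

section \<open>Irreducible Tutte polynomials\<close>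

text \<open>The substitution \<open>u \<mapsto> (x - 1) y\<close>.\<close>

definition scaled :: "rat poly poly \<Rightarrow> rat poly poly" where
  "scaled B = pcompose B [:0, [:-1, 1:]:]"

lemma scaled_const [simp]: "scaled [:c:] = [:c:]"
  by (simp add: scaled_def)

lemma scaled_monom_one: "scaled (monom 1 n) = ((var_x - 1) * var_y) ^ n"
proof -
  have "scaled [:0, 1:] = (var_x - 1) * var_y"
    by (simp add: scaled_def pcompose_pCons var_x_def var_y_def one_pCons)
  moreover have "scaled (p ^ n) = scaled p ^ n" for p
    by (induction n) (simp_all add: scaled_def pcompose_1 pcompose_mult)
  ultimately show ?thesis by (simp add: monom_altdef)
qed

lemma scaled_simps:
  "scaled 1 = 1"
  "scaled (p + q) = scaled p + scaled q"
  "scaled (p - q) = scaled p - scaled q"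
  "scaled (p * q) = scaled p * scaled q"
  by (simp_all add: scaled_def pcompose_1 pcompose_add pcompose_diff pcompose_mult)

text \<open>The facts about \<open>B\<close> needed for the two Eisenstein arguments, in a form preserved by both
  sums. The last three concern \<open>B(u, x u)\<close>, which is in effect the polynomial of the dual poset
  with its coefficients reversed: for series-parallel posets, duality is
  \<open>B(u, x) \<mapsto> u\<^bsup>|P|\<^esup> B(1 / u, x / u)\<close>.\<close>

definition tutte_form :: "'a rel \<Rightarrow> rat poly poly \<Rightarrow> bool" where
  "tutte_form P B \<longleftrightarrow> tutte P = scaled B \<and> degree B < card (Field P) \<and>
     at_one B = 1 \<and> (\<exists>k\<ge>1. coeff B 0 = [:0, 1:] ^ k) \<and>
     degree (twist B) = card (Field P) \<and> (\<exists>k. lead_coeff (twist B) = [:0, 1:] ^ k) \<and>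
     at_one (twist B) = monom 1 (card (Field P))"

section \<open>The polynomials \<open>B\<close> of series-parallel posets\<close>

lemma tutte_form_one: "tutte_form {(a, a)} [:[:0, 1:]:]"
proof -
  have "twist [:[:0, 1:]:] = monom [:0, 1:] 1" using twist_const_power[of 1] by simp
  moreover have "at_one [:[:0, 1:]:] = 1"
    using at_one_monom[of "[:0, 1:]" 0] by (simp add: monom_0)
  moreover have "\<exists>k\<ge>1. ([:0, 1:] :: rat poly) = [:0, 1:] ^ k"
    by (rule exI[of _ 1]) simp
  moreover have "\<exists>k. ([:0, 1:] :: rat poly) = [:0, 1:] ^ k"
    by (rule exI[of _ 1]) simp
  ultimately show ?thesis
    by (simp add: tutte_form_def tutte_one Field_one var_x_def degree_monom_eq)
qed

lemma tutte_form_direct_sum: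
  assumes fin: "finite (Field P)" "finite (Field Q)" and disj: "Field P \<inter> Field Q = {}"
    and P: "tutte_form P B" and Q: "tutte_form Q C"
  shows "tutte_form (direct_sum P Q) (B * C)"
  unfolding tutte_form_def
proof (intro conjI)
  let ?p = "card (Field P)" and ?q = "card (Field Q)"
  have card: "card (Field (direct_sum P Q)) = ?p + ?q"
    using assms by (simp add: Field_direct_sum card_Un_disjoint)
  show "tutte (direct_sum P Q) = scaled (B * C)"
    using P Q unfolding tutte_direct_sum[OF fin disj] by (simp add: tutte_form_def scaled_simps)
  have "degree B < ?p" "degree C < ?q" using P Q by (simp_all add: tutte_form_def)
  then show "degree (B * C) < card (Field (direct_sum P Q))"
    using degree_mult_le[of B C] unfolding card by linarith
  show "at_one (B * C) = 1" using P Q by (simp add: tutte_form_def at_one.hom_mult)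
  obtain k l where "k \<ge> 1" "coeff B 0 = [:0, 1:] ^ k" "coeff C 0 = [:0, 1:] ^ l"
    using P Q by (auto simp: tutte_form_def)
  then have "k + l \<ge> 1 \<and> coeff (B * C) 0 = [:0, 1:] ^ (k + l)"
    by (simp add: coeff_mult_0 power_add)
  then show "\<exists>k\<ge>1. coeff (B * C) 0 = [:0, 1:] ^ k" by blast
  obtain k l where "lead_coeff (twist B) = [:0, 1:] ^ k" "lead_coeff (twist C) = [:0, 1:] ^ l"
    using P Q by (auto simp: tutte_form_def)
  then have lead: "lead_coeff (twist (B * C)) = [:0, 1:] ^ (k + l)"
    unfolding twist.hom_mult lead_coeff_mult power_add by simp
  then show "\<exists>k. lead_coeff (twist (B * C)) = [:0, 1:] ^ k" by blast
  have "twist (B * C) \<noteq> 0" using lead by force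
  then have "twist B \<noteq> 0" "twist C \<noteq> 0" by (auto simp: twist.hom_mult)
  then show "degree (twist (B * C)) = card (Field (direct_sum P Q))"
    using P Q by (simp add: twist.hom_mult degree_mult_eq card tutte_form_def)
  show "at_one (twist (B * C)) = monom 1 (card (Field (direct_sum P Q)))"
    using P Q
    by (simp add: twist.hom_mult at_one.hom_mult card tutte_form_def mult_monom)
qed

lemma degree_diff_one: "degree (p - 1 :: 'a :: comm_ring_1 poly) \<le> degree p"
  using degree_diff_le_max[of p 1] by simp

text \<open>Since \<open>degree C < card (Field Q)\<close>, the constant coefficient comes from
  \<open>C\<close> alone. After \<open>twist\<close>, which fixes powers of u, the top term comes
  from \<open>B\<close> alone.\<close>

lemma tutte_form_ordinal_sum:
  assumes fin: "finite (Field P)" "finite (Field Q)" and disj: "Field P \<inter> Field Q = {}"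
    and P: "tutte_form P B" and Q: "tutte_form Q C"
  shows "tutte_form (ordinal_sum P Q) (C + monom 1 (card (Field Q)) * (B - 1))"
    (is "tutte_form _ ?F")
  unfolding tutte_form_def
proof (intro conjI)
  let ?p = "card (Field P)" and ?q = "card (Field Q)"
  have card: "card (Field (ordinal_sum P Q)) = ?q + ?p"
    using assms by (simp add: Field_ordinal_sum card_Un_disjoint)
  have deg: "degree B < ?p" "degree C < ?q" using P Q by (simp_all add: tutte_form_def)
  show "tutte (ordinal_sum P Q) = scaled ?F"
    using P Q unfolding tutte_ordinal_sum[OF fin disj]
    by (simp add: tutte_form_def scaled_simps scaled_monom_one)
  have "degree (monom 1 ?q * (B - 1)) \<le> ?q + degree B"
    using degree_mult_le[of "monom 1 ?q" "B - 1"] degree_monom_le[of "1 :: rat poly" ?q]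
      degree_diff_one[of B] by linarith
  then show "degree ?F < card (Field (ordinal_sum P Q))"
    using deg unfolding card by (intro degree_add_less) linarith+
  show "at_one ?F = 1"
    using P Q
    by (simp add: tutte_form_def at_one.hom_add at_one.hom_diff at_one.hom_mult at_one.hom_1)
  show "\<exists>k\<ge>1. coeff ?F 0 = [:0, 1:] ^ k"
    using Q deg by (auto simp: tutte_form_def coeff_monom_mult)
  have tw: "twist ?F = twist C + monom 1 ?q * (twist B - 1)"
    by (simp add: twist.hom_add twist.hom_diff twist.hom_mult twist.hom_1 twist_monom_one)
  have dB: "degree (twist B) = ?p" and dC: "degree (twist C) = ?q"
    using P Q by (simp_all add: tutte_form_def)
  \<comment> \<open>The subtracted 1 has degree 0, below the positive number
    \<open>card (Field P)\<close>.\<close>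
  have cB: "coeff (twist B - 1) ?p = lead_coeff (twist B)"
    using dB deg by (simp add: coeff_1)
  have co: "coeff (twist ?F) (?q + ?p) = lead_coeff (twist B)"
    using dC deg cB unfolding tw by (simp add: coeff_monom_mult coeff_eq_0)
  obtain k where k: "lead_coeff (twist B) = [:0, 1:] ^ k" using P by (auto simp: tutte_form_def)
  have "degree (monom 1 ?q * (twist B - 1)) \<le> ?q + ?p"
    using degree_mult_le[of "monom 1 ?q" "twist B - 1"] degree_monom_le[of "1 :: rat poly" ?q]
      degree_diff_one[of "twist B"] dB by linarith
  then have "degree (twist ?F) \<le> ?q + ?p"
    unfolding tw using dC by (intro degree_add_le) linarith+
  moreover have "?q + ?p \<le> degree (twist ?F)"
    using co k by (intro le_degree) simp
  ultimately have d: "degree (twist ?F) = ?q + ?p" by linarith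
  then show "degree (twist ?F) = card (Field (ordinal_sum P Q))" unfolding card .
  show "\<exists>k. lead_coeff (twist ?F) = [:0, 1:] ^ k" using co k unfolding d by auto
  show "at_one (twist ?F) = monom 1 (card (Field (ordinal_sum P Q)))"
    using P Q unfolding tw card
    by (simp add: tutte_form_def at_one.hom_add at_one.hom_diff at_one.hom_mult at_one.hom_1
        right_diff_distrib mult_monom)
qed

lemma SP_tutte_form: "P \<in> SP \<Longrightarrow> \<exists>B. tutte_form P B"
proof (induction rule: SP.induct)
  case (SP_one a)
  show ?case by (rule exI, rule tutte_form_one)
next
  case (SP_direct_sum P Q)
  then show ?case using tutte_form_direct_sum SP_finite_poset by blast
next
  case (SP_ordinal_sum P Q)
  then show ?case using tutte_form_ordinal_sum SP_finite_poset by blast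
qed

section \<open>Irreducibility for ordinal sums with an antichain\<close>

lemma irreducible_scaled:
  assumes "irreducible B" "degree B > 0" "coeff B 0 = [:0, 1:] ^ k"
  shows "irreducible (scaled B)"
  unfolding scaled_def
proof (rule irreducible_pcompose_scale[OF assms(1,2)])
  show "coprime (coeff B 0) [:-1, 1:]"
  proof (rule coprimeI)
    fix d :: "rat poly" assume "d dvd coeff B 0" "d dvd [:-1, 1:]"
    \<comment> \<open>Writing x - 1 as x^1 - 1 makes the divisibility lemma applicable with exponent
      1.\<close>
    moreover have "[:-1, 1:] = ([:0, 1:] :: rat poly) ^ 1 - 1" by (simp add: one_pCons)
    ultimately show "d dvd 1"
      unfolding assms(3) by (intro dvd_power_and_power_minus_one[of d "[:0, 1:]" k 1]) simp_all
  qed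
qed simp

lemma X_power_minus_one_neq_0: "n > 0 \<Longrightarrow> ([:0, 1:] :: rat poly) ^ n - 1 \<noteq> 0"
  using poly_pderiv_power_minus_one[of n] by force

text \<open>The bound \<open>degree B < card (Field P)\<close> separates the two terms of
  \<open>?F\<close>, so the coefficients needed for \<open>reverse_eisenstein\<close> can be read
  off: x^n - 1 at the top and a power of x at the bottom.\<close>

lemma irreducible_tutte_antichain_ordinal_sum:
  assumes P: "P \<in> SP" and A: "finite A" "A \<noteq> {}" "A \<inter> Field P = {}"
  shows "irreducible (tutte (ordinal_sum (Id_on A) P))"
proof -
  obtain B where B: "tutte_form P B" using SP_tutte_form[OF P] by blast
  have fin: "finite (Field P)" using SP_finite_poset[OF P] by blast
  let ?m = "card (Field P)" and ?n = "card A"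
  have n: "?n > 0" using A by (simp add: card_gt_0_iff)
  have deg: "degree B < ?m" using B by (simp add: tutte_form_def)
  obtain k where k: "coeff B 0 = [:0, 1:] ^ k" using B by (auto simp: tutte_form_def)
  let ?c = "[:0, 1:] ^ ?n - 1 :: rat poly"
  let ?F = "B + monom 1 ?m * [:?c:]"
  have c: "[:?c:] = var_x ^ ?n - 1" by (simp add: var_x_def poly_const_pow one_pCons)
  have "tutte (ordinal_sum (Id_on A) P) = scaled B + ((var_x - 1) * var_y) ^ ?m * (var_x ^ ?n - 1)"
    using B A fin by (simp add: tutte_ordinal_sum tutte_antichain tutte_form_def)
  then have "tutte (ordinal_sum (Id_on A) P) = scaled ?F"
    unfolding scaled_simps scaled_monom_one scaled_const unfolding c .
  moreover have "irreducible (scaled ?F)"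
  proof (rule irreducible_scaled)
    have F: "?F = B + monom ?c ?m" by (simp add: smult_monom mult.commute)
    have co: "coeff ?F ?m = ?c" unfolding F using deg by (simp add: coeff_eq_0)
    have "degree ?F \<le> ?m"
      unfolding F using deg by (intro degree_add_le degree_monom_le) simp
    moreover have "?m \<le> degree ?F"
      using X_power_minus_one_neq_0[OF n] co by (intro le_degree) metis
    ultimately have dF: "degree ?F = ?m" by linarith
    then show "degree ?F > 0" using deg by linarith
    show F0: "coeff ?F 0 = [:0, 1:] ^ k" unfolding F using deg k by simp
    show "irreducible ?F"
    proof (rule reverse_eisenstein)
      show "at_one ?F = 1"
        unfolding F at_one.hom_add at_one_monom using B by (simp add: tutte_form_def)
      show "degree ?F > 0" by fact
      show "poly (pderiv (lead_coeff ?F)) 1 \<noteq> 0"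
        unfolding dF co poly_pderiv_power_minus_one using n by simp
      fix d assume "\<And>i. d dvd coeff ?F i"
      then have "d dvd [:0, 1:] ^ k" "d dvd ?c" using F0 co by metis+
      then show "d dvd 1" using n by (rule dvd_power_and_power_minus_one)
    qed
  qed
  ultimately show ?thesis by simp
qed

text \<open>The constant coefficient x^n of \<open>?F\<close> does not vanish at 1, so the criterion
  is applied after \<open>twist\<close>: there u^n splits off, and the cofactor \<open>?E\<close>
  has constant coefficient x^n - 1 and a power of x as leading coefficient.\<close>

lemma irreducible_tutte_ordinal_sum_antichain:
  assumes P: "P \<in> SP" and A: "finite A" "A \<noteq> {}" "Field P \<inter> A = {}"
  shows "irreducible (tutte (ordinal_sum P (Id_on A)))"
proof -
  obtain B where B: "tutte_form P B" using SP_tutte_form[OF P] by blast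
  have fin: "finite (Field P)" using SP_finite_poset[OF P] by blast
  let ?m = "card (Field P)" and ?n = "card A"
  have n: "?n > 0" using A by (simp add: card_gt_0_iff)
  have m: "?m > 0" using B by (auto simp: tutte_form_def)
  obtain k where k: "k \<ge> 1" "coeff B 0 = [:0, 1:] ^ k" using B by (auto simp: tutte_form_def)
  obtain l where l: "lead_coeff (twist B) = [:0, 1:] ^ l" using B by (auto simp: tutte_form_def)
  have dB: "degree (twist B) = ?m" using B by (simp add: tutte_form_def)
  let ?c = "[:0, 1:] ^ ?n - 1 :: rat poly"
  let ?F = "[:[:0, 1:] ^ ?n:] + monom 1 ?n * (B - 1)"
  let ?E = "[:?c:] + twist B"
  have "tutte (ordinal_sum P (Id_on A)) = scaled ?F"
    using B A fin
    by (simp add: tutte_ordinal_sum tutte_antichain tutte_form_def scaled_simps scaled_monom_one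
        var_x_def poly_const_pow)
  moreover have "irreducible (scaled ?F)"
  proof (rule irreducible_scaled)
    have co: "coeff ?F ?n = [:0, 1:] ^ k - 1"
      using n k(2) by (simp add: coeff_monom_mult coeff_pCons coeff_1 split: nat.splits)
    \<comment> \<open>The bound \<open>k \<ge> 1\<close> makes this coefficient nonzero and so gives
      \<open>?F\<close> positive degree in u.\<close>
    have "coeff ?F ?n \<noteq> 0" unfolding co using X_power_minus_one_neq_0[of k] k(1) by simp
    then show "degree ?F > 0" using n le_degree by (meson less_le_trans)
    show F0: "coeff ?F 0 = [:0, 1:] ^ ?n" using n by (simp add: coeff_monom_mult)
    show "irreducible ?F"
    proof (rule irreducible_of_twist)
      have tm: "monom ([:0, 1:] ^ ?n) ?n = monom 1 ?n * [:[:0, 1:] ^ ?n:]" by (simp add: smult_monom)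
      have c: "[:?c:] = [:[:0, 1:] ^ ?n:] - 1" by (simp add: one_pCons)
      show "twist ?F = monom 1 ?n * ?E"
        unfolding twist.hom_add twist.hom_mult twist.hom_diff twist_monom_one twist.hom_1
          twist_const_power tm
        unfolding c by (simp only: distrib_left right_diff_distrib add_diff_eq diff_add_eq)
      show "coeff ?F 0 \<noteq> 0" unfolding F0 by simp
      \<comment> \<open>At u^0 only the rational constant term of \<open>B\<close> remains, and it
        is 0 because \<open>coeff B 0\<close> is x^k with \<open>k \<ge> 1\<close>.\<close>
      have tB0: "coeff (twist B) 0 = 0"
        by (rule poly_eqI) (use k in \<open>auto simp: coeff_twist coeff_0_power power_0_left\<close>)
      have E0: "coeff ?E 0 = ?c" using tB0 by simp
      have Em: "coeff ?E ?m = [:0, 1:] ^ l" using m l dB by (simp add: coeff_pCons split: nat.splits)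
      have dE: "degree ?E = ?m" using m dB by (simp add: degree_add_eq_right)
      show "irreducible ?E"
      proof (rule eisenstein)
        have "at_one [:?c:] = 0" using at_one_monom[of ?c 0] by (simp add: monom_0)
        then show "at_one ?E = monom 1 (degree ?E)"
          unfolding at_one.hom_add dE using B by (simp add: tutte_form_def)
        show "degree ?E > 0" unfolding dE by fact
        show "poly (pderiv (coeff ?E 0)) 1 \<noteq> 0"
          unfolding E0 poly_pderiv_power_minus_one using n by simp
        fix d assume "\<And>i. d dvd coeff ?E i"
        then have "d dvd [:0, 1:] ^ l" "d dvd ?c" using E0 Em by metis+
        then show "d dvd 1" using n by (rule dvd_power_and_power_minus_one)
      qed
    qed
  qed
  ultimately show ?thesis by simp
qed

section \<open>Components and cocomponents\<close>

lemma irreducible_tutte_one: "irreducible (tutte {(a, a)})"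
  by (simp add: tutte_one var_x_def irreducible_const_poly_iff irreducible_linear_field_poly)

text \<open>Replacing closure under duals by closure under \<open>\<^bold>n \<oplus> P\<close> makes structural induction
  usable; the result contains \<open>class_P\<close> because it is still closed under duals.\<close>

inductive_set class_S :: "'a rel set" where
  one: "{(a, a)} \<in> class_S"
| direct_sum: "P \<in> class_S \<Longrightarrow> Q \<in> class_S \<Longrightarrow> Field P \<inter> Field Q = {} \<Longrightarrow> direct_sum P Q \<in> class_S"
| antichain_above: "P \<in> class_S \<Longrightarrow> finite A \<Longrightarrow> A \<noteq> {} \<Longrightarrow> Field P \<inter> A = {} \<Longrightarrow>
    ordinal_sum P (Id_on A) \<in> class_S"
| antichain_below: "P \<in> class_S \<Longrightarrow> finite A \<Longrightarrow> A \<noteq> {} \<Longrightarrow> A \<inter> Field P = {} \<Longrightarrow>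
    ordinal_sum (Id_on A) P \<in> class_S"

text \<open>Needed for cocomponents: in an ordinal sum with an antichain, the antichain is itself a
  cocomponent.\<close>

lemma class_S_antichain: "finite A \<Longrightarrow> A \<noteq> {} \<Longrightarrow> Id_on A \<in> class_S"
proof (induction A rule: finite_ne_induct)
  case (singleton a)
  have "Id_on {a} = {(a, a)}" by auto
  then show ?case by (simp add: class_S.one)
next
  case (insert a A)
  then show ?case
    unfolding Id_on_insert by (intro class_S.direct_sum class_S.one) (simp_all add: Field_one)
qed

lemma SP_antichain: "finite A \<Longrightarrow> A \<noteq> {} \<Longrightarrow> Id_on A \<in> SP"
proof (induction A rule: finite_ne_induct)
  case (singleton a)
  have "Id_on {a} = {(a, a)}" by auto
  then show ?case by (simp add: SP.SP_one)
next
  case (insert a A)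
  then show ?case
    unfolding Id_on_insert by (intro SP.SP_direct_sum SP.SP_one) (simp_all add: Field_one)
qed

lemma class_S_imp_SP: "P \<in> class_S \<Longrightarrow> P \<in> SP"
  by (induction rule: class_S.induct) (simp_all add: SP.intros SP_antichain)

lemma converse_direct_sum: "(direct_sum P Q)\<inverse> = direct_sum (P\<inverse>) (Q\<inverse>)"
  by (auto simp: direct_sum_def)

lemma converse_ordinal_sum: "(ordinal_sum P Q)\<inverse> = ordinal_sum (Q\<inverse>) (P\<inverse>)"
  by (auto simp: ordinal_sum_def)

text \<open>Duality exchanges the two antichain rules.\<close>

lemma class_S_converse: "P \<in> class_S \<Longrightarrow> P\<inverse> \<in> class_S"
proof (induction rule: class_S.induct)
  case (one a)
  have "{(a, a)}\<inverse> = {(a, a)}" by auto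
  then show ?case by (simp add: class_S.one)
next
  case (direct_sum P Q)
  then show ?case unfolding converse_direct_sum by (intro class_S.direct_sum) simp_all
next
  case (antichain_above P A)
  then show ?case unfolding converse_ordinal_sum converse_Id_on
    by (intro class_S.antichain_below) (simp_all add: Int_commute)
next
  case (antichain_below P A)
  then show ?case unfolding converse_ordinal_sum converse_Id_on
    by (intro class_S.antichain_above) (simp_all add: Int_commute)
qed

lemma class_P_imp_class_S: "P \<in> class_P \<Longrightarrow> P \<in> class_S"
proof (induction rule: class_P.induct)
  case (class_P_ordinal_sum P n A)
  then have "A \<noteq> {}" by auto
  then show ?case using class_P_ordinal_sum by (intro class_S.antichain_above) simp_all
qed (simp_all add: class_S.one class_S.direct_sum class_S_converse)

section \<open>Reachability and components of graphs\<close>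

lemma mem_components: "C \<in> components G \<longleftrightarrow> (\<exists>v\<in>verts G. C = reachable G `` {v})"
  by (auto simp: components_def quotient_def)

lemma reachable_sub_verts:
  assumes "edges G \<subseteq> Pow (verts G)" "(u, v) \<in> reachable G" "u \<in> verts G"
  shows "v \<in> verts G"
  using assms(2) unfolding reachable_def by (induction rule: rtrancl_induct) (use assms in auto)

lemma component_subset:
  assumes "edges G \<subseteq> Pow (verts G)" "C \<in> components G"
  shows "C \<subseteq> verts G"
  using assms(2) reachable_sub_verts[OF assms(1)] unfolding mem_components by auto

lemma component_of_connected:
  assumes "edges G \<subseteq> Pow (verts G)" "connected_graph G" "C \<in> components G"
  shows "C = verts G"
proof
  show "C \<subseteq> verts G" using component_subset[OF assms(1,3)] .
  show "verts G \<subseteq> C" using assms(2,3) unfolding connected_graph_def mem_components by blast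
qed

lemma reachable_edge: "{u, v} \<in> edges G \<Longrightarrow> (u, v) \<in> reachable G"
  unfolding reachable_def by auto

lemma reachable_refl: "(u, u) \<in> reachable G"
  unfolding reachable_def by auto

lemma reachable_trans: "(u, v) \<in> reachable G \<Longrightarrow> (v, w) \<in> reachable G \<Longrightarrow> (u, w) \<in> reachable G"
  unfolding reachable_def by auto

text \<open>Every vertex reaches \<open>a\<close> either directly or through \<open>b\<close>. This
  serves comparability graphs of ordinal sums and complements for direct sums alike.\<close>

lemma connected_of_cross_edges:
  assumes verts: "verts G = U \<union> V" and ne: "U \<noteq> {}" "V \<noteq> {}"
    and cross: "\<And>u v. u \<in> U \<Longrightarrow> v \<in> V \<Longrightarrow> {u, v} \<in> edges G"
  shows "connected_graph G"
proof -
  obtain a b where ab: "a \<in> U" "b \<in> V" using ne by blast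
  have UV: "(u, v) \<in> reachable G" "(v, u) \<in> reachable G" if "u \<in> U" "v \<in> V" for u v
    using cross[OF that] by (auto intro: reachable_edge simp: insert_commute)
  have "(x, a) \<in> reachable G" "(a, x) \<in> reachable G" if "x \<in> verts G" for x
    using that ab UV unfolding verts by (blast intro: reachable_trans)+
  then show ?thesis unfolding connected_graph_def by (blast intro: reachable_trans)
qed

text \<open>A walk starting in one part stays there, since every edge lies inside one of the two
  vertex sets.\<close>

lemma component_of_disjoint_union:
  assumes verts: "verts G = verts G1 \<union> verts G2" "verts G1 \<inter> verts G2 = {}"
    and edges: "edges G = edges G1 \<union> edges G2"
    and sub: "edges G1 \<subseteq> Pow (verts G1)" "edges G2 \<subseteq> Pow (verts G2)"
    and C: "C \<in> components G"
  shows "C \<in> components G1 \<or> C \<in> components G2"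
proof -
  \<comment> \<open>General \<open>H\<close> and \<open>K\<close> allow the two parts to exchange
    roles.\<close>
  have eq: "reachable G `` {v} = reachable H `` {v}"
    if v: "v \<in> verts H" and HK: "verts H \<inter> verts K = {}" "edges G = edges H \<union> edges K"
      "edges H \<subseteq> Pow (verts H)" "edges K \<subseteq> Pow (verts K)" for v H K
  proof -
    have "w \<in> verts H \<and> (v, w) \<in> reachable H" if "(v, w) \<in> reachable G" for w
      using that unfolding reachable_def[of G]
    proof (induction rule: rtrancl_induct)
      case base
      then show ?case using v by (simp add: reachable_refl)
    next
      case (step w z)
      have "{w, z} \<in> edges H" using step HK by blast
      then show ?case using step HK(3) by (blast intro: reachable_trans reachable_edge)
    qed
    moreover have "reachable H \<subseteq> reachable G"
      unfolding reachable_def HK(2) by (rule rtrancl_mono) auto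
    ultimately show ?thesis by blast
  qed
  obtain v where v: "v \<in> verts G1 \<union> verts G2" "C = reachable G `` {v}"
    using C verts unfolding mem_components by auto
  show ?thesis
  proof (cases "v \<in> verts G1")
    case True
    then show ?thesis
      using eq[OF True verts(2) edges sub] v unfolding mem_components by blast
  next
    case False
    then have 2: "v \<in> verts G2" using v by simp
    have "verts G2 \<inter> verts G1 = {}" "edges G = edges G2 \<union> edges G1" using verts edges by auto
    from eq[OF 2 this sub(2,1)] show ?thesis using v 2 unfolding mem_components by blast
  qed
qed

section \<open>Comparability graphs of sums and their complements\<close>

lemma verts_graphs [simp]:
  "verts (comparability_graph P) = Field P"
  "verts (graph_complement G) = verts G"
  by (simp_all add: comparability_graph_def graph_complement_def)

lemma edge_comparability_graph:
  "{u, v} \<in> edges (comparability_graph P) \<longleftrightarrow> u \<noteq> v \<and> ((u, v) \<in> P \<or> (v, u) \<in> P)"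
  by (auto simp: comparability_graph_def doubleton_eq_iff)

lemma edges_comparability_graph:
  "edges (comparability_graph P) \<subseteq> Pow (verts (comparability_graph P))"
  by (auto simp: comparability_graph_def Field_def)

lemma edge_graph_complement:
  "{u, v} \<in> edges (graph_complement G) \<longleftrightarrow>
    u \<in> verts G \<and> v \<in> verts G \<and> u \<noteq> v \<and> {u, v} \<notin> edges G"
  by (auto simp: graph_complement_def doubleton_eq_iff)

lemma edges_graph_complement: "edges (graph_complement G) \<subseteq> Pow (verts (graph_complement G))"
  by (auto simp: graph_complement_def)

lemma edges_direct_sum:
  "edges (comparability_graph (direct_sum P Q)) =
    edges (comparability_graph P) \<union> edges (comparability_graph Q)"
  by (auto simp: comparability_graph_def direct_sum_def)

text \<open>All pairs across the summands are comparable, so the complement has no edge between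
  them.\<close>

lemma edges_complement_ordinal_sum:
  assumes "Field P \<inter> Field Q = {}"
  shows "edges (graph_complement (comparability_graph (ordinal_sum P Q))) =
    edges (graph_complement (comparability_graph P)) \<union>
    edges (graph_complement (comparability_graph Q))" (is "?L = ?M \<union> ?N")
proof -
  have doubleton: "\<exists>u v. e = {u, v}" if "e \<in> edges (graph_complement G)" for e and G :: "'a ugraph"
    using that by (auto simp: graph_complement_def)
  have "{u, v} \<in> ?L \<longleftrightarrow> {u, v} \<in> ?M \<union> ?N" for u v
  proof -
    have "\<not> (u \<in> Field P \<and> u \<in> Field Q)" "\<not> (v \<in> Field P \<and> v \<in> Field Q)"
      using assms by auto
    then show ?thesis
      using in_Field[of u v P] in_Field[of v u P] in_Field[of u v Q] in_Field[of v u Q]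
      unfolding Un_iff edge_graph_complement edge_comparability_graph verts_graphs
        in_ordinal_sum Field_ordinal_sum by blast
  qed
  then show ?thesis using doubleton by blast
qed

lemma component_ordinal_sum:
  assumes "Field P \<noteq> {}" "Field Q \<noteq> {}" "Field P \<inter> Field Q = {}"
    and C: "C \<in> components (comparability_graph (ordinal_sum P Q))"
  shows "C = Field (ordinal_sum P Q)"
proof -
  have "connected_graph (comparability_graph (ordinal_sum P Q))"
    by (rule connected_of_cross_edges[of _ "Field P" "Field Q"])
      (use assms in \<open>auto simp: Field_ordinal_sum edge_comparability_graph in_ordinal_sum\<close>)
  from component_of_connected[OF edges_comparability_graph this C] show ?thesis by simp
qed

lemma cocomponent_direct_sum:
  assumes "Field P \<noteq> {}" "Field Q \<noteq> {}" "Field P \<inter> Field Q = {}"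
    and C: "C \<in> components (graph_complement (comparability_graph (direct_sum P Q)))"
  shows "C = Field (direct_sum P Q)"
proof -
  have "connected_graph (graph_complement (comparability_graph (direct_sum P Q)))"
  proof (rule connected_of_cross_edges[of _ "Field P" "Field Q"])
    fix u v assume "u \<in> Field P" "v \<in> Field Q"
    then show "{u, v} \<in> edges (graph_complement (comparability_graph (direct_sum P Q)))"
      using assms(3) in_Field[of u v P] in_Field[of v u P] in_Field[of u v Q] in_Field[of v u Q]
      unfolding edge_graph_complement edge_comparability_graph verts_graphs
        Field_direct_sum in_direct_sum by blast
  qed (use assms in \<open>auto simp: Field_direct_sum\<close>)
  from component_of_connected[OF edges_graph_complement this C] show ?thesis by simp
qed

text \<open>The incomparability graph of an antichain is complete.\<close>

lemma cocomponent_antichain: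
  assumes "C \<in> components (graph_complement (comparability_graph (Id_on A)))"
  shows "C = A"
proof -
  have "(u, v) \<in> reachable (graph_complement (comparability_graph (Id_on A)))"
    if "u \<in> A" "v \<in> A" for u v
    using that reachable_refl[of u]
    by (cases "u = v") (auto intro!: reachable_edge simp: edge_graph_complement edge_comparability_graph)
  then have "connected_graph (graph_complement (comparability_graph (Id_on A)))"
    by (simp add: connected_graph_def)
  from component_of_connected[OF edges_graph_complement this assms] show ?thesis by simp
qed

section \<open>Components and cocomponents of posets in \<open>class_S\<close>\<close>

lemma Restr_Field: "Restr P (Field P) = P"
  by (auto simp: Field_def)

lemma Restr_sums:
  assumes "Field P \<inter> Field Q = {}"
  shows "C \<subseteq> Field P \<Longrightarrow> Restr (direct_sum P Q) C = Restr P C"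
    and "D \<subseteq> Field Q \<Longrightarrow> Restr (direct_sum P Q) D = Restr Q D"
    and "C \<subseteq> Field P \<Longrightarrow> Restr (ordinal_sum P Q) C = Restr P C"
    and "D \<subseteq> Field Q \<Longrightarrow> Restr (ordinal_sum P Q) D = Restr Q D"
  using assms unfolding direct_sum_def ordinal_sum_def by (blast dest: in_Field)+

lemma Field_class_S: "P \<in> class_S \<Longrightarrow> finite (Field P) \<and> Field P \<noteq> {}"
  using SP_finite_poset class_S_imp_SP by blast

text \<open>A component of a direct sum is a component of one summand, where induction applies. The
  other posets of the class are connected, so the component is everything and the irreducibility
  results apply.\<close>

lemma class_S_component:
  assumes "P \<in> class_S" "C \<in> components (comparability_graph P)"
  shows "Restr P C \<in> class_S \<and> irreducible (tutte (Restr P C))"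
  using assms
proof (induction arbitrary: C rule: class_S.induct)
  case (one a)
  have "connected_graph (comparability_graph {(a, a)})"
    by (simp add: connected_graph_def Field_one reachable_refl)
  from component_of_connected[OF edges_comparability_graph this one]
  have "C = Field {(a, a)}" by simp
  then have "Restr {(a, a)} C = {(a, a)}" by (simp only: Restr_Field)
  then show ?case by (simp add: class_S.one irreducible_tutte_one)
next
  case (direct_sum P Q)
  have "C \<in> components (comparability_graph P) \<or> C \<in> components (comparability_graph Q)"
    by (rule component_of_disjoint_union[OF _ _ edges_direct_sum
          edges_comparability_graph edges_comparability_graph direct_sum.prems])
      (simp_all add: Field_direct_sum direct_sum.hyps)
  then show ?case
  proof
    assume C: "C \<in> components (comparability_graph P)"
    then have "C \<subseteq> Field P" using component_subset[OF edges_comparability_graph] by simp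
    with direct_sum C show ?thesis by (simp add: Restr_sums)
  next
    assume C: "C \<in> components (comparability_graph Q)"
    then have "C \<subseteq> Field Q" using component_subset[OF edges_comparability_graph] by simp
    with direct_sum C show ?thesis by (simp add: Restr_sums)
  qed
next
  case (antichain_above P A)
  then have "C = Field (ordinal_sum P (Id_on A))"
    using Field_class_S by (intro component_ordinal_sum) auto
  then have "Restr (ordinal_sum P (Id_on A)) C = ordinal_sum P (Id_on A)"
    by (simp only: Restr_Field)
  with antichain_above show ?case
    by (simp add: class_S.antichain_above irreducible_tutte_ordinal_sum_antichain class_S_imp_SP)
next
  case (antichain_below P A)
  then have "C = Field (ordinal_sum (Id_on A) P)"
    using Field_class_S by (intro component_ordinal_sum) auto
  then have "Restr (ordinal_sum (Id_on A) P) C = ordinal_sum (Id_on A) P"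
    by (simp only: Restr_Field)
  with antichain_below show ?case
    by (simp add: class_S.antichain_below irreducible_tutte_antichain_ordinal_sum class_S_imp_SP)
qed

text \<open>The roles of the sums are exchanged: a direct sum is a single cocomponent, while an
  ordinal sum with an antichain splits into the cocomponents of \<open>P\<close> and the
  antichain.\<close>

lemma class_S_cocomponent:
  assumes "P \<in> class_S" "C \<in> components (graph_complement (comparability_graph P))"
  shows "Restr P C \<in> class_S"
  using assms
proof (induction arbitrary: C rule: class_S.induct)
  case (one a)
  have "{(a, a)} = Id_on {a}" by auto
  then have "C = Field {(a, a)}" using one cocomponent_antichain[of C "{a}"] by (simp add: Field_one)
  then have "Restr {(a, a)} C = {(a, a)}" by (simp only: Restr_Field)
  then show ?case by (simp add: class_S.one)
next
  case (direct_sum P Q)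
  then have "C = Field (direct_sum P Q)"
    using Field_class_S by (intro cocomponent_direct_sum) auto
  then have "Restr (direct_sum P Q) C = direct_sum P Q" by (simp only: Restr_Field)
  with direct_sum show ?case by (simp add: class_S.direct_sum)
next
  case (antichain_above P A)
  have disj: "Field P \<inter> Field (Id_on A) = {}" using antichain_above by simp
  have "C \<in> components (graph_complement (comparability_graph P)) \<or>
      C \<in> components (graph_complement (comparability_graph (Id_on A)))"
    using disj
    by (intro component_of_disjoint_union[OF _ _ edges_complement_ordinal_sum[OF disj]
          edges_graph_complement edges_graph_complement antichain_above.prems])
      (simp_all add: Field_ordinal_sum)
  then show ?case
  proof
    assume C: "C \<in> components (graph_complement (comparability_graph P))"
    have "C \<subseteq> Field P" using component_subset[OF edges_graph_complement C] by simp
    with antichain_above.IH[OF C] disj show ?thesis by (simp add: Restr_sums)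
  next
    assume "C \<in> components (graph_complement (comparability_graph (Id_on A)))"
    then have "C = Field (Id_on A)" using cocomponent_antichain by simp
    then have "Restr (ordinal_sum P (Id_on A)) C = Id_on A"
      using Restr_sums(4)[OF disj order_refl] by (simp only: Restr_Field)
    with antichain_above show ?thesis by (simp add: class_S_antichain)
  qed
next
  case (antichain_below P A)
  have disj: "Field (Id_on A) \<inter> Field P = {}" using antichain_below by simp
  have "C \<in> components (graph_complement (comparability_graph (Id_on A))) \<or>
      C \<in> components (graph_complement (comparability_graph P))"
    using disj
    by (intro component_of_disjoint_union[OF _ _ edges_complement_ordinal_sum[OF disj]
          edges_graph_complement edges_graph_complement antichain_below.prems])
      (simp_all add: Field_ordinal_sum)
  then show ?case
  proof
    assume C: "C \<in> components (graph_complement (comparability_graph P))"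
    have "C \<subseteq> Field P" using component_subset[OF edges_graph_complement C] by simp
    with antichain_below.IH[OF C] disj show ?thesis by (simp add: Restr_sums)
  next
    assume "C \<in> components (graph_complement (comparability_graph (Id_on A)))"
    then have "C = Field (Id_on A)" using cocomponent_antichain by simp
    then have "Restr (ordinal_sum (Id_on A) P) C = Id_on A"
      using Restr_sums(3)[OF disj order_refl] by (simp only: Restr_Field)
    with antichain_below show ?thesis by (simp add: class_S_antichain)
  qed
qed

section \<open>Passage to the members of \<open>family_W\<close>\<close>

lemma induced_comparability_graph:
  assumes "Field (Restr P W) = W"
  shows "induced_subgraph (comparability_graph P) W = comparability_graph (Restr P W)"
  using assms by (auto simp: induced_subgraph_def comparability_graph_def)

lemma induced_complement_comparability_graph:
  assumes "Field (Restr P W) = W" "W \<subseteq> Field P"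
  shows "induced_subgraph (graph_complement (comparability_graph P)) W =
    graph_complement (comparability_graph (Restr P W))"
proof -
  have "{e \<in> edges (graph_complement (comparability_graph P)). e \<subseteq> W} =
      edges (graph_complement (comparability_graph (Restr P W)))" (is "?L = ?R")
  proof -
    have "\<exists>u v. e = {u, v}" if "e \<in> ?L \<or> e \<in> ?R" for e
      using that by (auto simp: graph_complement_def)
    moreover have "{u, v} \<in> ?L \<longleftrightarrow> {u, v} \<in> ?R" for u v
      using assms unfolding mem_Collect_eq edge_graph_complement edge_comparability_graph verts_graphs
      by blast
    ultimately show ?thesis by blast
  qed
  then show ?thesis
    using assms(1) by (simp add: induced_subgraph_def graph_complement_def comparability_graph_def)
qed

lemma Restr_Restr: "C \<subseteq> W \<Longrightarrow> Restr (Restr P W) C = Restr P C"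
  by auto

text \<open>Components of the subgraph induced on \<open>W\<close> are components of the graph of
  \<open>Restr P W\<close>, likewise for complements, so each step of the family stays in the
  class.\<close>

lemma class_S_family_W:
  assumes P: "P \<in> class_S" and "W \<in> family_W P"
  shows "W \<subseteq> Field P \<and> Restr P W \<in> class_S"
  using assms(2)
proof induction
  case family_W_top
  then show ?case using P by (simp only: Restr_Field order_refl simp_thms)
next
  \<comment> \<open>By reflexivity, restricting the relation loses no point of
    \<open>W\<close>.\<close>
  have F: "Field (Restr P W) = W" if "W \<subseteq> Field P" for W
    using that SP_finite_poset[OF class_S_imp_SP[OF P]]
    by (auto simp: Refl_Field_Restr partial_order_on_def preorder_on_def)
  {
    case (family_W_component W C)
    then have C: "C \<in> components (comparability_graph (Restr P W))"
      by (simp add: induced_comparability_graph F)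
    then have "C \<subseteq> W"
      using component_subset[OF edges_comparability_graph C] family_W_component F by simp
    with class_S_component[OF _ C] family_W_component show ?case by (auto simp: Restr_Restr)
  next
    case (family_W_cocomponent W C)
    then have C: "C \<in> components (graph_complement (comparability_graph (Restr P W)))"
      by (simp add: induced_complement_comparability_graph F)
    then have "C \<subseteq> W"
      using component_subset[OF edges_graph_complement C] family_W_cocomponent F by simp
    with class_S_cocomponent[OF _ C] family_W_cocomponent show ?case by (auto simp: Restr_Restr)
  }
qed

theorem theorem1p3:
  shows "(class_P :: 'a rel set) \<subseteq> class_H"
proof
  fix P :: "'a rel" assume "P \<in> class_P"
  then have P: "P \<in> class_S" by (rule class_P_imp_class_S)
  have "irreducible (tutte (Restr P C))"
    if W: "W \<in> family_W P" and C: "C \<in> components (comparability_graph (Restr P W))" for W C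
  proof -
    have S: "Restr P W \<in> class_S" using class_S_family_W[OF P W] by simp
    have "C \<subseteq> Field (Restr P W)"
      using component_subset[OF edges_comparability_graph C] by simp
    also have "\<dots> \<subseteq> W" by (auto simp: Field_def)
    finally have "Restr (Restr P W) C = Restr P C" by (rule Restr_Restr)
    then show ?thesis using class_S_component[OF S C] by simp
  qed
  then show "P \<in> class_H" using class_S_imp_SP[OF P] by (simp add: class_H_def)
qed

end
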